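(* Let $d=2$, let $\varphi(x)=\sum_{i=1}^N d_i(x)f(c_i(x))$ be the cost built from landmarks $x_1,\dots,x_N\in\mathbb{R}^2$, a home location $x_g\in\mathbb{R}^2$ and a reshaping function $f:[-1,1]\to\mathbb{R}$, and let $\rho>0$ and $k_\theta>0$ be arbitrary. Consider the closed-loop unicycle system with state $z=(x,\theta)$, $x\in\mathbb{R}^2$, $$\dot x=\nu\begin{bmatrix}\cos\theta\\ \sin\theta\end{bmatrix},\qquad \dot\theta=\omega,$$ with the control inputs $$\nu=\begin{bmatrix}\cos\theta & \sin\theta\end{bmatrix} g,\qquad \omega=\begin{cases}\rho\sum_{i:a_i>0}a_i+k_\theta & \text{if }\theta_e\le 0,\\ \rho\sum_{i:a_i<0}a_i-k_\theta & \text{if }\theta_e>0,\end{cases}$$ where $g$, $a_i$ and $\theta_e$ are the functions of the state defined in the context. Let $z(t)=(x(t),\theta(t))$, $t\ge 0$, be any trajectory of this system, contained in the region where the controls are defined, such that $d_i(x(t))^{-1}<\rho$ for all $i$ and all $t\geq 0$. Then $x(t)$ converges in finite time to a curve in the gradient flow of $\varphi$: there is $T<\infty$ such that $\dot x(t)=-\nabla\varphi(x(t))$ for all $t> T$.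
   Context: For $x\in\mathbb{R}^2\setminus\{x_1,\dots,x_N\}$: $d_i(x)=\|x_i-x\|$, $\beta_i(x)=d_i(x)^{-1}(x_i-x)$, $\beta_{gi}=\beta_i(x_g)$ (with $x_g\ne x_i$ for all $i$), $c_i(x)=\beta_{gi}^T\beta_i(x)$, $P_{\beta_i}=I-\beta_i\beta_i^T$. Set $g=(g_1,g_2)^T=-\nabla\varphi(x)$, $\theta_d=\arctan_2(g_2,g_1)$ (the angle of the vector $g$, four-quadrant inverse tangent), and let $$\theta_e=\operatorname{mod}(\theta-\theta_d+\pi,2\pi)-\pi\in[-\pi,\pi)$$ be the signed angle error. Further, $$S=\begin{bmatrix}0&1\\-1&0\end{bmatrix},\qquad H_i=\bigl(\ddot f(c_i)(c_i\beta_i-\beta_{gi})\beta_{gi}^T+(\dot f(c_i)c_i-f(c_i))I\bigr)P_{\beta_i},$$ $$a_i=\frac{g^TSH_i\dot x}{\|g\|^2},\qquad \dot x=\nu\begin{bmatrix}\cos\theta\\ \sin\theta\end{bmatrix}.$$ The controls are defined in the region of those $x\in\mathbb{R}^2\setminus\{x_1,\dots,x_N\}$ with $\nabla\varphi(x)\neq0$ and with every $c_i(x)$ in the relatively open subset of $[-1,1]$ on which $f$ is twice continuously differentiable (one-sidedly at the endpoints $\pm1$). Since the feedback $\omega$ is discontinuous across $\theta_e=0$, trajectories are understood in the usual sense of sliding mode control (Filippov solutions). The angle $\theta$ may be regarded as real-valued, since the dynamics depend on it only modulo $2\pi$. *)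

theory Defs
  imports "HOL-Analysis.Analysis" "HOL-Library.Real_Mod"
begin

definition grad :: "('a::real_inner \<Rightarrow> real) \<Rightarrow> 'a \<Rightarrow> 'a" where
  "grad h x = (THE D. GDERIV h x :> D)"

definition arctan2 :: "real \<Rightarrow> real \<Rightarrow> real" where
  "arctan2 y x = Arg (Complex x y)"

text \<open>
  The reshaping function is modelled by a total function, but only its values on
  \<open>{-1..1}\<close> are used. Its derivatives are taken within \<open>{-1..1}\<close>, hence one-sidedly at
  the endpoints.
\<close>

definition fdot :: "(real \<Rightarrow> real) \<Rightarrow> real \<Rightarrow> real" where
  "fdot f c = vector_derivative f (at c within {-1..1})"

definition fddot :: "(real \<Rightarrow> real) \<Rightarrow> real \<Rightarrow> real" where
  "fddot f c = vector_derivative (fdot f) (at c within {-1..1})"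

definition C2_on :: "(real \<Rightarrow> real) \<Rightarrow> real set \<Rightarrow> bool" where
  "C2_on f V \<longleftrightarrow>
     (\<forall>c\<in>V. f differentiable (at c within {-1..1})) \<and>
     (\<forall>c\<in>V. fdot f differentiable (at c within {-1..1})) \<and>
     continuous_on V (fddot f)"

definition C2_region :: "(real \<Rightarrow> real) \<Rightarrow> real set" where
  "C2_region f = \<Union>{V. openin (top_of_set {-1..1}) V \<and> C2_on f V}"

text \<open>The landmarks are \<open>X 1, \<dots>, X N\<close>; the home location is \<open>xg\<close>.\<close>

definition dst :: "(nat \<Rightarrow> real^2) \<Rightarrow> nat \<Rightarrow> real^2 \<Rightarrow> real" where
  "dst X i x = norm (X i - x)"

definition bearing :: "(nat \<Rightarrow> real^2) \<Rightarrow> nat \<Rightarrow> real^2 \<Rightarrow> real^2" where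
  "bearing X i x = inverse (dst X i x) *\<^sub>R (X i - x)"

definition cang :: "(nat \<Rightarrow> real^2) \<Rightarrow> real^2 \<Rightarrow> nat \<Rightarrow> real^2 \<Rightarrow> real" where
  "cang X xg i x = bearing X i xg \<bullet> bearing X i x"

definition cost :: "nat \<Rightarrow> (nat \<Rightarrow> real^2) \<Rightarrow> real^2 \<Rightarrow> (real \<Rightarrow> real) \<Rightarrow> real^2 \<Rightarrow> real" where
  "cost N X xg f x = (\<Sum>i=1..N. dst X i x * f (cang X xg i x))"

definition negrad :: "nat \<Rightarrow> (nat \<Rightarrow> real^2) \<Rightarrow> real^2 \<Rightarrow> (real \<Rightarrow> real) \<Rightarrow> real^2 \<Rightarrow> real^2" where
  "negrad N X xg f x = - grad (cost N X xg f) x"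

definition control_region ::
    "nat \<Rightarrow> (nat \<Rightarrow> real^2) \<Rightarrow> real^2 \<Rightarrow> (real \<Rightarrow> real) \<Rightarrow> (real^2) set" where
  "control_region N X xg f =
     {x. x \<notin> X ` {1..N} \<and> grad (cost N X xg f) x \<noteq> 0 \<and>
         (\<forall>i\<in>{1..N}. cang X xg i x \<in> C2_region f)}"

definition heading :: "real \<Rightarrow> real^2" where
  "heading \<theta> = vector [cos \<theta>, sin \<theta>]"

definition Smat :: "real^2^2" where
  "Smat = vector [vector [0, 1], vector [-1, 0]]"

definition outer :: "real^2 \<Rightarrow> real^2 \<Rightarrow> real^2^2" where
  "outer u v = (\<chi> i j. u $ i * v $ j)"

definition Pmat :: "(nat \<Rightarrow> real^2) \<Rightarrow> nat \<Rightarrow> real^2 \<Rightarrow> real^2^2" where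
  "Pmat X i x = mat 1 - outer (bearing X i x) (bearing X i x)"

definition Hmat ::
    "(nat \<Rightarrow> real^2) \<Rightarrow> real^2 \<Rightarrow> (real \<Rightarrow> real) \<Rightarrow> nat \<Rightarrow> real^2 \<Rightarrow> real^2^2" where
  "Hmat X xg f i x =
     (let c = cang X xg i x; b = bearing X i x; bg = bearing X i xg in
        (fddot f c *\<^sub>R outer (c *\<^sub>R b - bg) bg + (fdot f c * c - f c) *\<^sub>R mat 1) ** Pmat X i x)"

definition nu ::
    "nat \<Rightarrow> (nat \<Rightarrow> real^2) \<Rightarrow> real^2 \<Rightarrow> (real \<Rightarrow> real) \<Rightarrow> (real^2) \<times> real \<Rightarrow> real" where
  "nu N X xg f = (\<lambda>(x, \<theta>). heading \<theta> \<bullet> negrad N X xg f x)"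

text \<open>
  Inside the control law, \<open>x'\<close> denotes the function \<open>xvel\<close> of the state \<open>(x, \<theta>)\<close>, not the derivative
  of a trajectory.
\<close>

definition xvel ::
    "nat \<Rightarrow> (nat \<Rightarrow> real^2) \<Rightarrow> real^2 \<Rightarrow> (real \<Rightarrow> real) \<Rightarrow> (real^2) \<times> real \<Rightarrow> real^2" where
  "xvel N X xg f = (\<lambda>(x, \<theta>). nu N X xg f (x, \<theta>) *\<^sub>R heading \<theta>)"

definition acoef ::
    "nat \<Rightarrow> (nat \<Rightarrow> real^2) \<Rightarrow> real^2 \<Rightarrow> (real \<Rightarrow> real) \<Rightarrow> nat \<Rightarrow> (real^2) \<times> real \<Rightarrow> real" where
  "acoef N X xg f i = (\<lambda>(x, \<theta>).
     (let g = negrad N X xg f x in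
        (g \<bullet> (Smat *v (Hmat X xg f i x *v xvel N X xg f (x, \<theta>)))) / (norm g)\<^sup>2))"

definition theta_d :: "nat \<Rightarrow> (nat \<Rightarrow> real^2) \<Rightarrow> real^2 \<Rightarrow> (real \<Rightarrow> real) \<Rightarrow> real^2 \<Rightarrow> real" where
  "theta_d N X xg f x = arctan2 (negrad N X xg f x $ 2) (negrad N X xg f x $ 1)"

definition theta_e ::
    "nat \<Rightarrow> (nat \<Rightarrow> real^2) \<Rightarrow> real^2 \<Rightarrow> (real \<Rightarrow> real) \<Rightarrow> (real^2) \<times> real \<Rightarrow> real" where
  "theta_e N X xg f = (\<lambda>(x, \<theta>). (\<theta> - theta_d N X xg f x + pi) rmod (2 * pi) - pi)"

definition omega ::
    "nat \<Rightarrow> (nat \<Rightarrow> real^2) \<Rightarrow> real^2 \<Rightarrow> (real \<Rightarrow> real) \<Rightarrow> real \<Rightarrow> real \<Rightarrow> (real^2) \<times> real \<Rightarrow> real" where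
  "omega N X xg f \<rho> k\<theta> z =
     (if theta_e N X xg f z \<le> 0
      then \<rho> * (\<Sum>i | i \<in> {1..N} \<and> acoef N X xg f i z > 0. acoef N X xg f i z) + k\<theta>
      else \<rho> * (\<Sum>i | i \<in> {1..N} \<and> acoef N X xg f i z < 0. acoef N X xg f i z) - k\<theta>)"

definition closed_loop ::
    "nat \<Rightarrow> (nat \<Rightarrow> real^2) \<Rightarrow> real^2 \<Rightarrow> (real \<Rightarrow> real) \<Rightarrow> real \<Rightarrow> real
      \<Rightarrow> (real^2) \<times> real \<Rightarrow> (real^2) \<times> real" where
  "closed_loop N X xg f \<rho> k\<theta> z = (xvel N X xg f z, omega N X xg f \<rho> k\<theta> z)"

text \<open>
  Absolute continuity: the finite families of non-overlapping compact intervals are the divisions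
  \<open>\<D> division_of A\<close>.
\<close>

definition abs_continuous_on :: "real set \<Rightarrow> (real \<Rightarrow> 'a::real_normed_vector) \<Rightarrow> bool" where
  "abs_continuous_on S z \<longleftrightarrow>
     (\<forall>\<epsilon>>0. \<exists>\<delta>>0. \<forall>\<D> A. \<D> division_of A \<and> A \<subseteq> S \<and> (\<Sum>K\<in>\<D>. measure lborel K) < \<delta> \<longrightarrow>
        (\<Sum>K\<in>\<D>. norm (z (Sup K) - z (Inf K))) < \<epsilon>)"

text \<open>The Filippov regularisation of a vector field \<open>F\<close> defined on the open set \<open>D\<close>.\<close>

definition filippov_map ::
    "'a::euclidean_space set \<Rightarrow> ('a \<Rightarrow> 'a) \<Rightarrow> 'a \<Rightarrow> 'a set" where
  "filippov_map D F z =
     (\<Inter>\<delta>\<in>{0<..}. \<Inter>M\<in>{M. negligible M}. closure (convex hull (F ` (ball z \<delta> \<inter> D - M))))"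

definition filippov_solution ::
    "'a::euclidean_space set \<Rightarrow> ('a \<Rightarrow> 'a) \<Rightarrow> (real \<Rightarrow> 'a) \<Rightarrow> bool" where
  "filippov_solution D F z \<longleftrightarrow>
     (\<forall>t\<ge>0. z t \<in> D) \<and>
     (\<forall>b\<ge>0. abs_continuous_on {0..b} z) \<and>
     (AE t in lebesgue_on {0..}.
        \<exists>v\<in>filippov_map D F (z t). (z has_vector_derivative v) (at t within {0..}))"

end

theory Submission
  imports Defs
begin

text \<open>
  Write \<open>g = -\<nabla>\<phi>\<close>, let \<open>h\<close> be the heading and \<open>w = (h \<bullet> g) / \<parallel>g\<parallel>\<close>, the cosine of the angle error
  \<open>\<theta>\<^sub>e\<close>. The proof follows \<open>w\<close> instead of \<open>\<theta>\<^sub>e\<close>: it is a \<open>C\<^sup>1\<close> function of the state, whereas \<open>\<theta>\<^sub>e\<close>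
  jumps at \<open>\<plusminus>\<pi>\<close>.

  The Jacobian of \<open>g\<close> is \<open>\<Sum> d\<^sub>i\<inverse> H\<^sub>i\<close> (\<open>gfield_has_derivative\<close>), so along the closed loop the direction of
  \<open>g\<close> rotates at the rate \<open>\<Sum> a\<^sub>i / d\<^sub>i\<close>, and \<open>\<theta>\<^sub>e\<close> changes at the rate \<open>\<omega> - \<Sum> a\<^sub>i / d\<^sub>i\<close>. Since
  \<open>0 < d\<^sub>i\<inverse> < \<rho>\<close>, the sum over the coefficients of one sign in \<open>\<omega>\<close> dominates this rotation and leaves at least
  \<open>k\<^sub>\<theta>\<close> towards \<open>\<theta>\<^sub>e = 0\<close>; hence \<open>w' \<ge> k\<^sub>\<theta> \<bar>sin \<theta>\<^sub>e\<bar> = k\<^sub>\<theta> \<surd>(1 - w\<^sup>2)\<close> almost everywhere (\<open>cos_error_rate\<close>).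
  The estimate holds for every velocity that the Filippov regularisation allows: where \<open>sin \<theta>\<^sub>e \<noteq> 0\<close> the vector
  field is continuous, so its Filippov set is a single point, and where \<open>sin \<theta>\<^sub>e = 0\<close> the
  differential of \<open>w\<close> vanishes, so every velocity satisfies the bound.

  The function \<open>w\<close> is absolutely continuous along the trajectory, hence nondecreasing. Either it is \<open>-1\<close> for all
  time, or it exceeds \<open>-1\<close> at some time, and from then on \<open>\<surd>(1 - w)\<close> decreases at a rate bounded away
  from \<open>0\<close> until \<open>w = 1\<close> (\<open>finite_time_saturation\<close>). The first case is a repelling sliding mode of the
  switching law at \<open>\<theta>\<^sub>e = \<plusminus>\<pi>\<close>. There the unicycle points exactly
  against \<open>g\<close> and drives backwards: in both cases \<open>h\<close> is parallel to \<open>g\<close> and \<open>(h \<bullet> g) h = g\<close>.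

  So from some time on \<open>x' = g\<close> almost everywhere. Since \<open>x\<close> is absolutely continuous and \<open>g\<close> is
  continuous along it, the equation holds at every time (\<open>abs_continuous_has_continuous_derivative\<close>).
\<close>

section \<open>Absolutely continuous functions\<close>

lemma division_member_real:
  fixes A :: "real set"
  assumes "\<D> division_of A" "K \<in> \<D>"
  obtains u v where "u \<le> v" "K = {u..v}" "u \<in> A" "v \<in> A"
proof -
  obtain u v where K: "K = {u..v}"
    using division_ofD(4)[OF assms] by (metis box_real(2))
  moreover have "K \<noteq> {}" "K \<subseteq> A"
    using division_ofD(2,3)[OF assms] by auto
  ultimately show thesis
    using that[of u v] by (auto simp: subset_iff)
qed

lemma abs_continuous_on_subset:
  "abs_continuous_on S z \<Longrightarrow> T \<subseteq> S \<Longrightarrow> abs_continuous_on T z"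
  unfolding abs_continuous_on_def by (meson subset_trans)

text \<open>
  The two functions may take values in different spaces; this covers Lipschitz images, coordinates
  and inner products with a fixed vector.
\<close>

lemma abs_continuous_on_dominated:
  assumes z: "abs_continuous_on S z"
    and dom: "\<And>u v. u \<in> S \<Longrightarrow> v \<in> S \<Longrightarrow> norm (w v - w u) \<le> C * norm (z v - z u)"
  shows "abs_continuous_on S w"
  unfolding abs_continuous_on_def
proof (intro allI impI)
  fix \<epsilon> :: real assume "\<epsilon> > 0"
  define C' where "C' = \<bar>C\<bar> + 1"
  have "C' > 0" "\<epsilon> / C' > 0"
    using \<open>\<epsilon> > 0\<close> by (auto simp: C'_def)
  have dom': "norm (w v - w u) \<le> C' * norm (z v - z u)" if "u \<in> S" "v \<in> S" for u v
    using order_trans[OF dom[OF that] mult_right_mono[of C C' "norm (z v - z u)"]]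
    by (simp add: C'_def)
  obtain \<delta> where "\<delta> > 0" and \<delta>: "\<And>\<D> A. \<D> division_of A \<Longrightarrow> A \<subseteq> S \<Longrightarrow>
      (\<Sum>K\<in>\<D>. measure lborel K) < \<delta> \<Longrightarrow> (\<Sum>K\<in>\<D>. norm (z (Sup K) - z (Inf K))) < \<epsilon> / C'"
    using z[unfolded abs_continuous_on_def] \<open>\<epsilon> / C' > 0\<close> by meson
  show "\<exists>\<delta>>0. \<forall>\<D> A. \<D> division_of A \<and> A \<subseteq> S \<and> (\<Sum>K\<in>\<D>. measure lborel K) < \<delta> \<longrightarrow>
      (\<Sum>K\<in>\<D>. norm (w (Sup K) - w (Inf K))) < \<epsilon>"
  proof (intro exI[of _ \<delta>] conjI allI impI \<open>\<delta> > 0\<close>)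
    fix \<D> A assume *: "\<D> division_of A \<and> A \<subseteq> S \<and> (\<Sum>K\<in>\<D>. measure lborel K) < \<delta>"
    have "(\<Sum>K\<in>\<D>. norm (w (Sup K) - w (Inf K))) \<le> (\<Sum>K\<in>\<D>. C' * norm (z (Sup K) - z (Inf K)))"
    proof (rule sum_mono)
      fix K assume "K \<in> \<D>"
      with * obtain u v where "u \<le> v" "K = {u..v}" "u \<in> S" "v \<in> S"
        by (meson division_member_real subsetD)
      then show "norm (w (Sup K) - w (Inf K)) \<le> C' * norm (z (Sup K) - z (Inf K))"
        using dom'[of u v] by simp
    qed
    also have "\<dots> = C' * (\<Sum>K\<in>\<D>. norm (z (Sup K) - z (Inf K)))"
      by (simp add: sum_distrib_left)
    also have "\<dots> < C' * (\<epsilon> / C')"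
      using \<delta>[of \<D> A] * \<open>C' > 0\<close> by (intro mult_strict_left_mono) auto
    finally show "(\<Sum>K\<in>\<D>. norm (w (Sup K) - w (Inf K))) < \<epsilon>"
      using \<open>C' > 0\<close> by simp
  qed
qed

lemma abs_continuous_on_imp_continuous_on:
  assumes "abs_continuous_on {a..b} z"
  shows "continuous_on {a..b} z"
  unfolding continuous_on_iff
proof (intro ballI allI impI)
  fix t \<epsilon> :: real assume t: "t \<in> {a..b}" and "\<epsilon> > 0"
  then obtain \<delta> where "\<delta> > 0" and \<delta>: "\<And>\<D> A. \<D> division_of A \<Longrightarrow> A \<subseteq> {a..b} \<Longrightarrow>
      (\<Sum>K\<in>\<D>. measure lborel K) < \<delta> \<Longrightarrow> (\<Sum>K\<in>\<D>. norm (z (Sup K) - z (Inf K))) < \<epsilon>"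
    using assms[unfolded abs_continuous_on_def] by meson
  have *: "norm (z v - z u) < \<epsilon>" if "u \<le> v" "v - u < \<delta>" "u \<in> {a..b}" "v \<in> {a..b}" for u v
    using \<delta>[of "{{u..v}}" "{u..v}"] that division_of_self[of u v] by auto
  show "\<exists>d>0. \<forall>s\<in>{a..b}. dist s t < d \<longrightarrow> dist (z s) (z t) < \<epsilon>"
  proof (intro exI[of _ \<delta>] conjI ballI impI \<open>\<delta> > 0\<close>)
    fix s assume "s \<in> {a..b}" "dist s t < \<delta>"
    then show "dist (z s) (z t) < \<epsilon>"
      using *[of s t] *[of t s] t by (cases "s \<le> t") (auto simp: dist_norm norm_minus_commute)
  qed
qed

lemma sum_content_division_less:
  fixes U :: "real set"
  assumes "\<D> division_of A" "A \<subseteq> U" "open U" "emeasure lebesgue U < ennreal e"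
  shows "(\<Sum>K\<in>\<D>. measure lborel K) < e"
proof -
  have U: "U \<in> lmeasurable"
    using assms by (intro fmeasurableI) (auto simp: less_top[symmetric] intro: less_trans)
  have "(\<Sum>K\<in>\<D>. measure lborel K) = (\<Sum>K\<in>\<D>. measure lebesgue K)"
  proof (rule sum.cong)
    fix K assume "K \<in> \<D>"
    then obtain u v where "K = cbox u v" using division_ofD(4)[OF assms(1)] by blast
    then show "measure lborel K = measure lebesgue K" by simp
  qed simp
  also have "\<dots> = measure lebesgue A"
    using content_division[OF assms(1)] .
  also have "\<dots> \<le> measure lebesgue U"
    using assms lmeasurable_division[OF assms(1)] U by (intro measure_mono_fmeasurable) auto
  also have "\<dots> < e"
    using assms(4) U by (metis emeasure_eq_measure2 ennreal_less_iff measure_nonneg)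
  finally show ?thesis .
qed

text \<open>
  An almost-everywhere bound on the derivative suffices because absolute continuity controls
  the exceptional null set \<open>E\<close>. Cover \<open>E\<close> by an open set \<open>U\<close> of small measure and choose a gauge that
  keeps intervals tagged in \<open>E\<close> inside \<open>U\<close>, and makes the difference quotient almost
  at least \<open>m\<close> on intervals tagged outside \<open>E\<close>. In a fine division of \<open>{a..b}\<close> the former intervals have
  small total length and so, by absolute continuity, contribute little to \<open>w b - w a\<close>.
\<close>

lemma abs_continuous_increment_ge:
  fixes w :: "real \<Rightarrow> real"
  assumes ac: "abs_continuous_on {a..b} w" and "a \<le> b" and E: "negligible E"
    and der: "\<And>t. t \<in> {a..b} - E \<Longrightarrow> \<exists>d\<ge>m. (w has_vector_derivative d) (at t within {a..b})"
  shows "m * (b - a) \<le> w b - w a"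
proof (rule field_le_epsilon)
  fix e' :: real assume "e' > 0"
  define e where "e = e' / (1 + \<bar>m\<bar> + (b - a))"
  have "e > 0"
    using \<open>e' > 0\<close> \<open>a \<le> b\<close> by (auto simp: e_def intro!: divide_pos_pos)
  obtain \<delta> where "\<delta> > 0" and \<delta>: "\<And>\<D> A. \<D> division_of A \<Longrightarrow> A \<subseteq> {a..b} \<Longrightarrow>
      (\<Sum>K\<in>\<D>. measure lborel K) < \<delta> \<Longrightarrow> (\<Sum>K\<in>\<D>. norm (w (Sup K) - w (Inf K))) < e"
    using ac[unfolded abs_continuous_on_def] \<open>e > 0\<close> by meson
  have E0: "E \<in> null_sets lebesgue"
    using E by (simp add: negligible_iff_null_sets)
  obtain U where U: "open U" "E \<subseteq> U" "emeasure lebesgue (U - E) < ennreal (min \<delta> e)"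
    using sets_lebesgue_outer_open[OF null_setsD2[OF E0], of "min \<delta> e"] \<open>\<delta> > 0\<close> \<open>e > 0\<close>
    by (metis min_less_iff_conj)
  then have Ue: "emeasure lebesgue U < ennreal (min \<delta> e)"
    using emeasure_Diff_null_set[OF E0, of U] by simp
  define good where "good t r \<longleftrightarrow> 0 < r \<and> (\<forall>y\<in>{a..b}. \<forall>u\<in>{a..b}. u \<le> t \<longrightarrow> t \<le> y \<longrightarrow>
      \<bar>y - t\<bar> < r \<longrightarrow> \<bar>u - t\<bar> < r \<longrightarrow> (m - e) * (y - u) \<le> w y - w u)" for t r
  have "\<exists>r>0. (t \<in> E \<longrightarrow> ball t r \<subseteq> U) \<and> (t \<in> {a..b} - E \<longrightarrow> good t r)" for t
  proof (cases "t \<in> {a..b} - E")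
    case True
    then obtain d where "d \<ge> m" and d: "(w has_vector_derivative d) (at t within {a..b})"
      using der by blast
    then obtain r where "r > 0" and r: "\<And>y. y \<in> {a..b} \<Longrightarrow> norm (y - t) < r \<Longrightarrow>
        norm (w y - w t - (y - t) *\<^sub>R d) \<le> e * norm (y - t)"
      using \<open>e > 0\<close> unfolding has_vector_derivative_def has_derivative_within_alt by meson
    have "good t r"
      unfolding good_def
    proof (intro conjI ballI impI \<open>r > 0\<close>)
      fix y u assume "y \<in> {a..b}" "u \<in> {a..b}" "u \<le> t" "t \<le> y" "\<bar>y - t\<bar> < r" "\<bar>u - t\<bar> < r"
      then have "(y - t) * d - e * (y - t) \<le> w y - w t" "w u - w t - (u - t) * d \<le> e * (t - u)"
        using r[of y] r[of u] by auto
      then have "(d - e) * (y - u) \<le> w y - w u"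
        by (simp add: algebra_simps)
      moreover have "(m - e) * (y - u) \<le> (d - e) * (y - u)"
        using \<open>d \<ge> m\<close> \<open>u \<le> t\<close> \<open>t \<le> y\<close> by (intro mult_right_mono) auto
      ultimately show "(m - e) * (y - u) \<le> w y - w u" by simp
    qed
    then show ?thesis using True \<open>r > 0\<close> by auto
  next
    case False
    then show ?thesis
      using U(1,2) open_contains_ball by (metis subset_eq zero_less_one)
  qed
  then obtain R where R: "\<And>t. R t > 0" "\<And>t. t \<in> E \<Longrightarrow> ball t (R t) \<subseteq> U"
    "\<And>t. t \<in> {a..b} - E \<Longrightarrow> good t (R t)"
    by metis
  have "gauge (\<lambda>t. ball t (R t))"
    using R(1) by (auto simp: gauge_def)
  then obtain p where p: "p tagged_division_of {a..b}" and fine: "(\<lambda>t. ball t (R t)) fine p"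
    using fine_division_exists_real by blast
  have piece: "\<exists>u v. K = {u..v} \<and> u \<le> t \<and> t \<le> v \<and> u \<in> {a..b} \<and> v \<in> {a..b} \<and> K \<subseteq> ball t (R t)"
    if tK: "(t, K) \<in> p" for t K
  proof -
    obtain u v where K: "K = {u..v}"
      using tagged_division_ofD(4)[OF p tK] by (metis box_real(2))
    moreover have "t \<in> K" "K \<subseteq> {a..b}" "K \<subseteq> ball t (R t)"
      using tagged_division_ofD(2,3)[OF p tK] fineD[OF fine tK] by auto
    ultimately show ?thesis by (intro exI[of _ u] exI[of _ v]) auto
  qed
  define B where "B = {q \<in> p. fst q \<in> E}"
  have "finite p" using p by blast
  have B: "B tagged_division_of (\<Union>(snd ` B))"
    using p unfolding B_def tagged_division_of_def[of p]
    by (auto intro!: tagged_partial_division_of_Union_self elim!: tagged_partial_division_subset)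
  have BU: "\<Union>(snd ` B) \<subseteq> U" "\<Union>(snd ` B) \<subseteq> {a..b}"
    using R(2) fineD[OF fine] tagged_division_ofD(3)[OF p] by (fastforce simp: B_def)+
  note BD = division_of_tagged_division[OF B]
  have small: "(\<Sum>K\<in>snd ` B. measure lborel K) < \<delta>" "(\<Sum>K\<in>snd ` B. measure lborel K) < e"
    using sum_content_division_less[OF BD BU(1) U(1) Ue] by auto
  have untag_nonempty: "(\<Sum>(t,K)\<in>B. if K = {} then 0 else \<bar>h (Sup K) - h (Inf K)\<bar>)
      = (\<Sum>K\<in>snd ` B. if K = {} then 0 else \<bar>h (Sup K) - h (Inf K)\<bar>)" for h :: "real \<Rightarrow> real"
    by (rule sum.over_tagged_division_lemma[OF B]) auto
  \<comment> \<open>Absolute continuity is about divisions, whereas \<open>B\<close> consists of tagged intervals; an interval can carry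
    two tags only if it is degenerate, and then its term is \<open>0\<close>.\<close>
  have untag: "(\<Sum>(t,K)\<in>B. \<bar>h (Sup K) - h (Inf K)\<bar>) = (\<Sum>K\<in>snd ` B. \<bar>h (Sup K) - h (Inf K)\<bar>)"
    for h :: "real \<Rightarrow> real"
  proof -
    have ne: "K \<noteq> {}" if "(t, K) \<in> B" for t K
      using that tagged_division_ofD(2)[OF B] by auto
    then have "(\<Sum>(t,K)\<in>B. \<bar>h (Sup K) - h (Inf K)\<bar>)
        = (\<Sum>(t,K)\<in>B. if K = {} then 0 else \<bar>h (Sup K) - h (Inf K)\<bar>)"
      by (intro sum.cong) auto
    also have "\<dots> = (\<Sum>K\<in>snd ` B. \<bar>h (Sup K) - h (Inf K)\<bar>)"
      unfolding untag_nonempty using ne by (intro sum.cong) auto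
    finally show ?thesis .
  qed
  have w_B: "(\<Sum>(t,K)\<in>B. \<bar>w (Sup K) - w (Inf K)\<bar>) < e"
    unfolding untag using \<delta>[OF BD BU(2) small(1)] by simp
  have "(\<Sum>K\<in>snd ` B. \<bar>Sup K - Inf K\<bar>) = (\<Sum>K\<in>snd ` B. measure lborel K)"
  proof (rule sum.cong)
    fix K assume "K \<in> snd ` B"
    then obtain u v where "u \<le> v" "K = {u..v}"
      using division_member_real[OF BD] by metis
    then show "\<bar>Sup K - Inf K\<bar> = measure lborel K" by simp
  qed simp
  then have id_B: "(\<Sum>(t,K)\<in>B. \<bar>Sup K - Inf K\<bar>) < e"
    using untag[of "\<lambda>x. x"] small(2) by simp
  \<comment> \<open>Lower bound term by term: \<open>m - e\<close> times the length everywhere, minus a correction on intervals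
    tagged in \<open>E\<close> that outweighs whatever \<open>w\<close> does there.\<close>
  have "(\<Sum>(t,K)\<in>p. m * (Sup K - Inf K) - e * (Sup K - Inf K)) - (\<Sum>(t,K)\<in>B. \<bar>w (Sup K) - w (Inf K)\<bar> + \<bar>m\<bar> * \<bar>Sup K - Inf K\<bar>)
    = (\<Sum>(t,K)\<in>p. m * (Sup K - Inf K) - e * (Sup K - Inf K)
        - (if t \<in> E then \<bar>w (Sup K) - w (Inf K)\<bar> + \<bar>m\<bar> * \<bar>Sup K - Inf K\<bar> else 0))"
    unfolding B_def using \<open>finite p\<close>
    by (simp add: sum_subtractf[symmetric] sum.inter_filter split_def)
  also have "\<dots> \<le> (\<Sum>(t,K)\<in>p. w (Sup K) - w (Inf K))"
  proof (rule sum_mono, clarify)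
    fix t K assume tK: "(t, K) \<in> p"
    then obtain u v where uv: "K = {u..v}" "u \<le> t" "t \<le> v" "u \<in> {a..b}" "v \<in> {a..b}"
      "K \<subseteq> ball t (R t)"
      using piece by blast
    then have S: "Sup K = v" "Inf K = u" "u \<le> v" by auto
    show "m * (Sup K - Inf K) - e * (Sup K - Inf K)
        - (if t \<in> E then \<bar>w (Sup K) - w (Inf K)\<bar> + \<bar>m\<bar> * \<bar>Sup K - Inf K\<bar> else 0)
        \<le> w (Sup K) - w (Inf K)"
    proof (cases "t \<in> E")
      case True
      have "m * (v - u) \<le> \<bar>m\<bar> * \<bar>v - u\<bar>" "0 \<le> e * (v - u)"
        using \<open>e > 0\<close> \<open>u \<le> v\<close> mult_right_mono[OF abs_ge_self, of "v - u" m] by simp_all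
      then show ?thesis unfolding S using True by simp
    next
      case False
      have "u \<in> K" "v \<in> K"
        using uv by auto
      then have "u \<in> ball t (R t)" "v \<in> ball t (R t)"
        using uv(6) by blast+
      then have "(m - e) * (v - u) \<le> w v - w u"
        using R(3)[of t] False uv unfolding good_def
        by (auto simp: dist_real_def abs_minus_commute)
      then show ?thesis unfolding S using False by (simp add: algebra_simps)
    qed
  qed
  also have "\<dots> = w b - w a"
    using additive_tagged_division_1[OF \<open>a \<le> b\<close> p] .
  also have "(\<Sum>(t,K)\<in>p. m * (Sup K - Inf K) - e * (Sup K - Inf K)) = m * (b - a) - e * (b - a)"
    using additive_tagged_division_1[OF \<open>a \<le> b\<close> p, of "\<lambda>x. m * x - e * x"]
    by (simp add: algebra_simps)
  also have "(\<Sum>(t,K)\<in>B. \<bar>w (Sup K) - w (Inf K)\<bar> + \<bar>m\<bar> * \<bar>Sup K - Inf K\<bar>)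
     = (\<Sum>(t,K)\<in>B. \<bar>w (Sup K) - w (Inf K)\<bar>) + \<bar>m\<bar> * (\<Sum>(t,K)\<in>B. \<bar>Sup K - Inf K\<bar>)"
    by (simp add: sum.distrib sum_distrib_left split_def)
  finally have "m * (b - a) - e * (b - a) \<le> w b - w a + (e + \<bar>m\<bar> * e)"
    using w_B mult_left_mono[OF less_imp_le[OF id_B], of "\<bar>m\<bar>"] by linarith
  moreover have "e' = e * (1 + \<bar>m\<bar> + (b - a))"
    using \<open>a \<le> b\<close> unfolding e_def by (simp add: field_simps add_nonneg_eq_0_iff)
  ultimately show "m * (b - a) \<le> w b - w a + e'"
    by (simp add: algebra_simps)
qed

text \<open>
  Reduction to the scalar case: project \<open>z\<close> on the direction of the error vector itself, so that the
  scalar estimate bounds the square of the length of the error.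
\<close>

lemma abs_continuous_increment_near:
  fixes z :: "real \<Rightarrow> 'a::real_inner"
  assumes ac: "abs_continuous_on {a..b} z" and "a \<le> b" and E: "negligible E" and "e \<ge> 0"
    and der: "\<And>t. t \<in> {a..b} - E \<Longrightarrow>
      \<exists>d. norm (d - m) \<le> e \<and> (z has_vector_derivative d) (at t within {a..b})"
  shows "norm (z b - z a - (b - a) *\<^sub>R m) \<le> e * (b - a)"
proof -
  define r where "r = z b - z a - (b - a) *\<^sub>R m"
  define w where "w t = - (r \<bullet> z t)" for t
  have "(- (r \<bullet> m) - norm r * e) * (b - a) \<le> w b - w a"
  proof (rule abs_continuous_increment_ge[OF _ \<open>a \<le> b\<close> E])
    show "abs_continuous_on {a..b} w"
    proof (rule abs_continuous_on_dominated[OF ac])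
      fix u v
      have "w v - w u = - (r \<bullet> (z v - z u))"
        by (simp add: w_def inner_diff_right)
      then show "norm (w v - w u) \<le> norm r * norm (z v - z u)"
        using Cauchy_Schwarz_ineq2[of r "z v - z u"] by simp
    qed
    fix t assume "t \<in> {a..b} - E"
    then obtain d where d: "norm (d - m) \<le> e" "(z has_vector_derivative d) (at t within {a..b})"
      using der by blast
    have "r \<bullet> (d - m) \<le> norm r * e"
      using norm_cauchy_schwarz[of r "d - m"] mult_left_mono[OF d(1), of "norm r"] by simp
    then have "- (r \<bullet> m) - norm r * e \<le> - (r \<bullet> d)"
      by (simp add: inner_diff_right)
    moreover have "(w has_vector_derivative - (r \<bullet> d)) (at t within {a..b})"
      using d(2) unfolding w_def has_vector_derivative_def
      by (auto intro!: derivative_eq_intros)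
    ultimately show "\<exists>d\<ge>- (r \<bullet> m) - norm r * e. (w has_vector_derivative d) (at t within {a..b})"
      by blast
  qed
  moreover have "w b - w a = - (r \<bullet> r) - (r \<bullet> m) * (b - a)"
    by (simp add: w_def r_def algebra_simps)
  ultimately have "norm r * norm r \<le> norm r * (e * (b - a))"
    by (simp add: dot_square_norm power2_eq_square algebra_simps)
  then show ?thesis
    unfolding r_def[symmetric] using \<open>e \<ge> 0\<close> \<open>a \<le> b\<close>
    by (cases "norm r = 0") (simp_all add: mult_le_cancel_left)
qed

text \<open>
  This upgrades a differential equation that holds almost everywhere to one that holds at every time:
  near \<open>t\<close> the almost-everywhere derivative is close to \<open>y t\<close>, hence so are all difference quotients.
\<close>

lemma abs_continuous_has_continuous_derivative:
  fixes z :: "real \<Rightarrow> 'a::real_inner"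
  assumes ac: "abs_continuous_on {a..b} z" and E: "negligible E"
    and der: "\<And>t. t \<in> {a..b} - E \<Longrightarrow> (z has_vector_derivative y t) (at t within {a..b})"
    and y: "continuous_on {a..b} y" and t: "t \<in> {a..b}"
  shows "(z has_vector_derivative y t) (at t within {a..b})"
  unfolding has_vector_derivative_def has_derivative_within_alt
proof (intro conjI allI impI bounded_linear_scaleR_left)
  fix e :: real assume "e > 0"
  then obtain \<delta> where "\<delta> > 0" and \<delta>: "\<And>s. s \<in> {a..b} \<Longrightarrow> dist s t < \<delta> \<Longrightarrow> dist (y s) (y t) < e"
    using y t unfolding continuous_on_iff by meson
  have inc: "norm (z v - z u - (v - u) *\<^sub>R y t) \<le> e * (v - u)"
    if "u \<le> v" "u \<in> {a..b}" "v \<in> {a..b}" "dist u t < \<delta>" "dist v t < \<delta>" "t \<in> {u..v}" for u v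
  proof (rule abs_continuous_increment_near[OF _ \<open>u \<le> v\<close> E])
    show "0 \<le> e" using \<open>e > 0\<close> by simp
    have sub: "{u..v} \<subseteq> {a..b}" using that by auto
    then show "abs_continuous_on {u..v} z"
      using ac abs_continuous_on_subset by blast
    fix s assume s: "s \<in> {u..v} - E"
    then have "dist s t < \<delta>" "s \<in> {a..b}"
      using that sub by (auto simp: dist_real_def)
    then have "norm (y s - y t) \<le> e"
      using \<delta>[of s] by (simp add: dist_norm)
    moreover have "(z has_vector_derivative y s) (at s within {u..v})"
      using der[of s] s sub has_vector_derivative_within_subset by blast
    ultimately show "\<exists>d. norm (d - y t) \<le> e \<and> (z has_vector_derivative d) (at s within {u..v})"
      by blast
  qed
  show "\<exists>d>0. \<forall>s\<in>{a..b}. norm (s - t) < d \<longrightarrow>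
      norm (z s - z t - (s - t) *\<^sub>R y t) \<le> e * norm (s - t)"
  proof (intro exI[of _ \<delta>] conjI ballI impI \<open>\<delta> > 0\<close>)
    fix s assume s: "s \<in> {a..b}" "norm (s - t) < \<delta>"
    show "norm (z s - z t - (s - t) *\<^sub>R y t) \<le> e * norm (s - t)"
    proof (cases "t \<le> s")
      case True
      then show ?thesis using inc[of t s] s t \<open>\<delta> > 0\<close> by (simp add: dist_norm)
    next
      case False
      have "z s - z t - (s - t) *\<^sub>R y t = - (z t - z s - (t - s) *\<^sub>R y t)"
        by (simp add: algebra_simps)
      then show ?thesis using inc[of s t] s t \<open>\<delta> > 0\<close> False by (simp only: norm_minus_cancel) (simp add: dist_norm)
    qed
  qed
qed

section \<open>Composition with continuously differentiable functions\<close>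

text \<open>
  The mean value inequality gives a local Lipschitz constant on
  balls, and compactness makes it uniform on \<open>K\<close>, convex or not. The operator norm of the derivative is bounded through its
  values on the basis, so continuity of \<open>\<Phi>'\<close> is only asked for in each fixed direction.
\<close>

lemma C1_imp_lipschitz_on_compact:
  fixes \<Phi> :: "'a::euclidean_space \<Rightarrow> real"
  assumes "open D" and der: "\<And>z. z \<in> D \<Longrightarrow> (\<Phi> has_derivative \<Phi>' z) (at z)"
    and cont: "\<And>e. continuous_on D (\<lambda>z. \<Phi>' z e)" and "compact K" "K \<subseteq> D"
  obtains L where "\<And>u v. u \<in> K \<Longrightarrow> v \<in> K \<Longrightarrow> norm (\<Phi> v - \<Phi> u) \<le> L * norm (v - u)"
proof -
  define B where "B z = (\<Sum>e\<in>Basis. norm (\<Phi>' z e))" for z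
  have "continuous_on D B"
    unfolding B_def by (intro continuous_on_sum continuous_on_norm cont)
  have "\<exists>u>0. \<exists>L. L-lipschitz_on (cball z u \<inter> D) \<Phi>" if zD: "z \<in> D" for z
  proof -
    obtain r where "r > 0" and r: "cball z r \<subseteq> D"
      using open_contains_cball_eq[OF \<open>open D\<close>] zD by auto
    then have "compact (B ` cball z r)"
      using \<open>continuous_on D B\<close> by (intro compact_continuous_image) (auto intro: continuous_on_subset)
    then obtain C where C: "\<And>y. y \<in> cball z r \<Longrightarrow> norm (B y) \<le> C"
      using compact_imp_bounded bounded_iff by (metis imageI)
    have "\<bar>C\<bar>-lipschitz_on (cball z r \<inter> D) \<Phi>"
    proof (rule lipschitz_onI)
      fix u v assume uv: "u \<in> cball z r \<inter> D" "v \<in> cball z r \<inter> D"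
      have "norm (\<Phi> u - \<Phi> v) \<le> \<bar>C\<bar> * norm (u - v)"
      proof (rule differentiable_bound[of "cball z r" \<Phi> \<Phi>'])
        fix y assume y: "y \<in> cball z r"
        then show "(\<Phi> has_derivative \<Phi>' y) (at y within cball z r)"
          using der r has_derivative_at_withinI by blast
        have "onorm (\<Phi>' y) \<le> B y"
          unfolding B_def using y r
          by (intro onorm_componentwise has_derivative_bounded_linear[OF der]) blast
        then show "onorm (\<Phi>' y) \<le> \<bar>C\<bar>"
          using C[OF y] by auto
      qed (use uv in auto)
      then show "dist (\<Phi> u) (\<Phi> v) \<le> \<bar>C\<bar> * dist u v"
        by (simp add: dist_norm)
    qed simp
    then show ?thesis using \<open>r > 0\<close> by blast
  qed
  then have "local_lipschitz {0::real} D (\<lambda>_. \<Phi>)"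
    by (intro local_lipschitzI) blast
  then have "local_lipschitz {0::real} K (\<lambda>_. \<Phi>)"
    using \<open>K \<subseteq> D\<close> by (rule local_lipschitz_subset[OF _ order_refl])
  then obtain L where L: "L-lipschitz_on K \<Phi>"
    using local_lipschitz_compact_implies_lipschitz[OF _ \<open>compact K\<close>, of "{0::real}" "\<lambda>_. \<Phi>"] by auto
  show thesis
    using that[of L] lipschitz_onD[OF L] by (simp add: dist_norm)
qed

lemma abs_continuous_on_C1_compose:
  fixes \<Phi> :: "'a::euclidean_space \<Rightarrow> real"
  assumes "open D" and "\<And>z. z \<in> D \<Longrightarrow> (\<Phi> has_derivative \<Phi>' z) (at z)"
    and "\<And>e. continuous_on D (\<lambda>z. \<Phi>' z e)"
    and ac: "abs_continuous_on {a..b} z" and "z ` {a..b} \<subseteq> D"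
  shows "abs_continuous_on {a..b} (\<lambda>t. \<Phi> (z t))"
proof -
  have "compact (z ` {a..b})"
    using abs_continuous_on_imp_continuous_on[OF ac] by (intro compact_continuous_image) auto
  from C1_imp_lipschitz_on_compact[OF assms(1-3) this assms(5)]
  obtain L where "\<And>u v. u \<in> z ` {a..b} \<Longrightarrow> v \<in> z ` {a..b} \<Longrightarrow> norm (\<Phi> v - \<Phi> u) \<le> L * norm (v - u)"
    by blast
  then show ?thesis
    by (intro abs_continuous_on_dominated[OF ac, of _ L]) blast
qed

section \<open>A differential inequality with finite-time saturation\<close>

text \<open>
  The right-hand side \<open>k \<surd>(1 - w\<^sup>2)\<close> is not Lipschitz at \<open>w = 1\<close>, which is what makes arrival in finite
  time possible. In terms of \<open>y = \<surd>(1 - w)\<close> the inequality reads \<open>y' \<le> - (k/2) \<surd>(1 + w)\<close>, and by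
  monotonicity of \<open>w\<close> the factor \<open>\<surd>(1 + w)\<close> is bounded below as soon as \<open>w\<close> has left \<open>-1\<close>. The
  equilibrium \<open>w = -1\<close> can be kept for all time, hence the alternative in the conclusion.
\<close>

lemma finite_time_saturation:
  fixes w :: "real \<Rightarrow> real"
  assumes ac: "\<And>b. b \<ge> 0 \<Longrightarrow> abs_continuous_on {0..b} w" and E: "negligible E"
    and w: "\<And>t. t \<ge> 0 \<Longrightarrow> -1 \<le> w t \<and> w t \<le> 1" and "k > 0"
    and der: "\<And>t. t \<ge> 0 \<Longrightarrow> t \<notin> E \<Longrightarrow>
      \<exists>d\<ge>k * sqrt (1 - (w t)\<^sup>2). (w has_vector_derivative d) (at t within {0..})"
  obtains T where "T \<ge> 0" "(\<forall>t\<ge>T. w t = -1) \<or> (\<forall>t\<ge>T. w t = 1)"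
proof (cases "\<forall>t\<ge>0. w t = -1")
  case True
  then show thesis using that[of 0] by simp
next
  case False
  then obtain t0 where t0: "t0 \<ge> 0" "w t0 > -1"
    using w by (metis order_le_less)
  have mono: "w s \<le> w t" if "0 \<le> s" "s \<le> t" for s t
  proof -
    have "0 * (t - s) \<le> w t - w s"
    proof (rule abs_continuous_increment_ge[OF _ \<open>s \<le> t\<close> E])
      show "abs_continuous_on {s..t} w"
        using ac[of t] that by (auto intro: abs_continuous_on_subset)
      fix r assume r: "r \<in> {s..t} - E"
      then have "0 \<le> r" "r \<notin> E" using \<open>0 \<le> s\<close> by auto
      then obtain d where d: "d \<ge> k * sqrt (1 - (w r)\<^sup>2)"
        "(w has_vector_derivative d) (at r within {0..})"
        using der by blast
      have "0 \<le> 1 - (w r)\<^sup>2"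
        using w[OF \<open>0 \<le> r\<close>] by (simp add: abs_square_le_1 abs_le_iff)
      then have "0 \<le> k * sqrt (1 - (w r)\<^sup>2)"
        using \<open>k > 0\<close> by simp
      then have "d \<ge> 0"
        using d(1) by linarith
      moreover have "(w has_vector_derivative d) (at r within {s..t})"
        using d(2) that by (auto intro: has_vector_derivative_within_subset)
      ultimately show "\<exists>d\<ge>0. (w has_vector_derivative d) (at r within {s..t})" by blast
    qed
    then show ?thesis by simp
  qed
  have "\<exists>t\<ge>t0. w t = 1"
  proof (rule ccontr)
    assume "\<not> (\<exists>t\<ge>t0. w t = 1)"
    then have lt1: "w t < 1" if "t \<ge> t0" for t
      using w[of t] t0 that by force
    define \<kappa> where "\<kappa> = k * sqrt (1 + w t0) / 2"
    have "\<kappa> > 0" using \<open>k > 0\<close> t0 by (simp add: \<kappa>_def)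
    define y where "y t = sqrt (1 - w t)" for t
    have y_pos: "y t > 0" if "t \<ge> t0" for t
      using lt1[OF that] by (simp add: y_def)
    \<comment> \<open>A time by which a decrease at rate \<open>\<kappa>\<close> would have made \<open>y\<close> negative.\<close>
    define b where "b = t0 + (y t0 + 1) / \<kappa>"
    have "b \<ge> t0" using y_pos[of t0] \<open>\<kappa> > 0\<close> by (simp add: b_def)
    have y_mono: "y b \<le> y t" if "t0 \<le> t" "t \<le> b" for t
      using mono[of t b] that t0 by (simp add: y_def)
    have "\<kappa> * (b - t0) \<le> - y b - - y t0"
    proof (rule abs_continuous_increment_ge[OF _ \<open>t0 \<le> b\<close> E])
      have acw: "abs_continuous_on {t0..b} w"
        using ac[of b] t0 \<open>b \<ge> t0\<close> by (auto intro: abs_continuous_on_subset)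
      \<comment> \<open>As \<open>w \<le> w b < 1\<close> on the interval, the square root is only used where it is Lipschitz.\<close>
      show "abs_continuous_on {t0..b} (\<lambda>t. - y t)"
      proof (rule abs_continuous_on_dominated[OF acw])
        fix u v assume uv: "u \<in> {t0..b}" "v \<in> {t0..b}"
        have yy: "y b \<le> y u + y v" "y u > 0" "y v > 0" "y b > 0"
          using y_mono[of u] y_pos[of v] y_pos[of u] y_pos[of b] uv by auto
        have "(y u - y v) * (y u + y v) = w v - w u"
          using lt1[of u] lt1[of v] uv by (simp add: y_def algebra_simps)
        then have "\<bar>y u - y v\<bar> * (y u + y v) = \<bar>w v - w u\<bar>"
          using yy by (metis abs_mult abs_of_pos add_pos_pos)
        then have "\<bar>y u - y v\<bar> * y b \<le> \<bar>w v - w u\<bar>"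
          using yy mult_left_mono[of "y b" "y u + y v" "\<bar>y u - y v\<bar>"] by simp
        then show "norm (- y v - - y u) \<le> (1 / y b) * norm (w v - w u)"
          using yy by (simp add: field_simps abs_minus_commute)
      qed
      fix t assume t: "t \<in> {t0..b} - E"
      then have "0 \<le> t" "t \<notin> E" using t0 by auto
      then obtain d where d: "d \<ge> k * sqrt (1 - (w t)\<^sup>2)"
        "(w has_vector_derivative d) (at t within {0..})"
        using der by blast
      have "(1 - (w t)\<^sup>2) = (1 + w t) * (1 - w t)"
        by (simp add: power2_eq_square algebra_simps)
      then have "sqrt (1 - (w t)\<^sup>2) = sqrt (1 + w t) * y t"
        by (simp add: real_sqrt_mult y_def)
      moreover have "sqrt (1 + w t0) \<le> sqrt (1 + w t)"
        using mono[of t0 t] t t0 by simp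
      ultimately have "k * (sqrt (1 + w t0) * y t) \<le> k * sqrt (1 - (w t)\<^sup>2)"
        using \<open>k > 0\<close> y_pos[of t] t by (simp add: mult_right_mono)
      then have "2 * \<kappa> * y t \<le> d"
        using d(1) by (simp add: \<kappa>_def)
      then have "\<kappa> \<le> d / (2 * y t)"
        using y_pos[of t] t by (simp add: field_simps)
      moreover have "((\<lambda>t. - y t) has_vector_derivative d / (2 * y t)) (at t within {t0..b})"
      proof -
        have dw: "(w has_real_derivative d) (at t within {t0..b})"
          using d(2) t0 has_vector_derivative_within_subset[of w d t "{0..}" "{t0..b}"]
          by (auto simp: has_real_derivative_iff_has_vector_derivative)
        have "((\<lambda>t. - y t) has_real_derivative d / (2 * y t)) (at t within {t0..b})"
          unfolding y_def using lt1[of t] t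
          by (auto intro!: derivative_eq_intros dw simp: field_simps)
        then show ?thesis
          by (simp add: has_real_derivative_iff_has_vector_derivative)
      qed
      ultimately show "\<exists>d\<ge>\<kappa>. ((\<lambda>t. - y t) has_vector_derivative d) (at t within {t0..b})"
        by blast
    qed
    moreover have "\<kappa> * (b - t0) = y t0 + 1"
      using \<open>\<kappa> > 0\<close> by (simp add: b_def)
    ultimately show False
      using y_pos[of b] \<open>b \<ge> t0\<close> by simp
  qed
  then obtain T where "T \<ge> t0" "w T = 1" by blast
  then have "\<forall>t\<ge>T. w t = 1"
    using mono[of T] w t0 by (metis dual_order.antisym order_trans)
  then show thesis
    using that[of T] \<open>T \<ge> t0\<close> t0 by simp
qed

section \<open>Filippov sets at points of partial continuity\<close>

text \<open>
  If a linear image \<open>P\<close> of the vector field is continuous at \<open>z\<close>, all nearby values lie in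
  the closed convex set of vectors whose image is close to \<open>P (F z)\<close>, and so does the closed convex
  hull. With \<open>P\<close> the identity the Filippov set is a point; with \<open>P\<close> a projection one component
  of the velocity is determined although another may be discontinuous.
\<close>

lemma filippov_map_continuous_part:
  fixes F :: "'a::euclidean_space \<Rightarrow> 'a" and P :: "'a \<Rightarrow> 'b::real_normed_vector"
  assumes P: "bounded_linear P" and cont: "continuous (at z within D) (\<lambda>y. P (F y))"
    and v: "v \<in> filippov_map D F z"
  shows "P v = P (F z)"
proof -
  have "dist (P v) (P (F z)) \<le> 0 + \<epsilon>" if "\<epsilon> > 0" for \<epsilon>
  proof -
    obtain \<delta> where "\<delta> > 0" and \<delta>: "\<And>y. y \<in> D \<Longrightarrow> dist y z < \<delta> \<Longrightarrow> dist (P (F y)) (P (F z)) < \<epsilon>"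
      using cont \<open>\<epsilon> > 0\<close> unfolding continuous_within_eps_delta by meson
    let ?C = "P -` cball (P (F z)) \<epsilon>"
    have "v \<in> closure (convex hull (F ` (ball z \<delta> \<inter> D - {})))"
      using v \<open>\<delta> > 0\<close> unfolding filippov_map_def
      by (simp only: INT_iff mem_Collect_eq greaterThan_iff) (use negligible_empty in blast)
    also have "\<dots> \<subseteq> ?C"
    proof (intro closure_minimal hull_minimal)
      show "F ` (ball z \<delta> \<inter> D - {}) \<subseteq> ?C"
        using \<delta> by (force simp: dist_commute)
      show "convex ?C"
        using P by (intro convex_linear_vimage bounded_linear.linear) auto
      show "closed ?C"
        using P by (intro closed_vimage) (auto simp: bounded_linear.continuous_on intro: linear_continuous_on)
    qed
    finally show ?thesis by (simp add: dist_commute)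
  qed
  then have "dist (P v) (P (F z)) \<le> 0"
    by (rule field_le_epsilon)
  then show ?thesis by simp
qed

section \<open>The gradient of the cost and its Jacobian\<close>

text \<open>
  Here the cost is differentiable with a \<open>C\<^sup>1\<close> gradient; the control region is the subset on which
  the gradient does not vanish.
\<close>

definition regular_region ::
    "nat \<Rightarrow> (nat \<Rightarrow> real^2) \<Rightarrow> real^2 \<Rightarrow> (real \<Rightarrow> real) \<Rightarrow> (real^2) set" where
  "regular_region N X xg f =
     {x. \<forall>i\<in>{1..N}. x \<noteq> X i \<and> cang X xg i x \<in> C2_region f}"

text \<open>
  Closed form of \<open>-\<nabla>\<phi>\<close> on the regular region. The factors \<open>d\<^sub>i\<close> of the cost cancel against the
  \<open>d\<^sub>i\<inverse>\<close> in the derivatives of \<open>c\<^sub>i\<close>.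
\<close>

definition gfield ::
    "nat \<Rightarrow> (nat \<Rightarrow> real^2) \<Rightarrow> real^2 \<Rightarrow> (real \<Rightarrow> real) \<Rightarrow> real^2 \<Rightarrow> real^2" where
  "gfield N X xg f x = (\<Sum>i=1..N. f (cang X xg i x) *\<^sub>R bearing X i x
     + fdot f (cang X xg i x) *\<^sub>R (bearing X i xg - cang X xg i x *\<^sub>R bearing X i x))"

lemma regular_regionD:
  assumes "x \<in> regular_region N X xg f" "i \<in> {1..N}"
  shows "x \<noteq> X i" "cang X xg i x \<in> C2_region f"
  using assms unfolding regular_region_def by blast+

lemma cang_bounds: "cang X xg i x \<in> {-1..1}"
proof -
  have b: "norm (bearing X i y) \<le> 1" for y
    by (cases "X i = y") (simp_all add: bearing_def dst_def)
  have "norm (bearing X i xg) * norm (bearing X i x) \<le> 1"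
    using b by (intro mult_le_one) auto
  then have "\<bar>cang X xg i x\<bar> \<le> 1"
    unfolding cang_def using Cauchy_Schwarz_ineq2 order_trans by blast
  then show ?thesis by auto
qed

lemma dst_pos: "x \<noteq> X i \<Longrightarrow> 0 < dst X i x"
  by (simp add: dst_def)

lemma dst_has_derivative:
  assumes "x \<noteq> X i"
  shows "(dst X i has_derivative (\<lambda>y. - (bearing X i x \<bullet> y))) (at x)"
proof -
  have "X i - x \<noteq> 0" using assms by simp
  then have "(norm has_derivative (\<lambda>h. h \<bullet> sgn (X i - x))) (at (X i - x))"
    by (rule has_derivative_norm)
  then have "((\<lambda>y. norm (X i - y)) has_derivative (\<lambda>y. (- y) \<bullet> sgn (X i - x))) (at x)"
    by (rule has_derivative_compose[rotated]) (auto intro!: derivative_eq_intros)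
  then show ?thesis
    by (simp add: dst_def[abs_def] bearing_def sgn_div_norm inner_commute divide_inverse)
qed

lemma bearing_has_derivative:
  assumes "x \<noteq> X i"
  shows "(bearing X i has_derivative
    (\<lambda>y. - inverse (dst X i x) *\<^sub>R (y - (bearing X i x \<bullet> y) *\<^sub>R bearing X i x))) (at x)"
proof -
  have d: "dst X i x \<noteq> 0" using dst_pos[of x X i] assms by simp
  have b: "bearing X i = (\<lambda>x. inverse (dst X i x) *\<^sub>R (X i - x))"
    by (simp add: bearing_def fun_eq_iff)
  have inv: "((\<lambda>x. inverse (dst X i x)) has_derivative
     (\<lambda>y. - (inverse (dst X i x) * - (bearing X i x \<bullet> y) * inverse (dst X i x)))) (at x)"
    by (rule Deriv.has_derivative_inverse[OF d dst_has_derivative[of x X i, OF assms]])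
  have scale: "inverse (dst X i x) *\<^sub>R (- y) +
        (- (inverse (dst X i x) * - (bearing X i x \<bullet> y) * inverse (dst X i x))) *\<^sub>R (X i - x)
      = - inverse (dst X i x) *\<^sub>R (y - (bearing X i x \<bullet> y) *\<^sub>R bearing X i x)" for y
  proof -
    define e r where "e = inverse (dst X i x)" and "r = bearing X i x \<bullet> y"
    have "bearing X i x = e *\<^sub>R (X i - x)"
      by (simp add: bearing_def e_def)
    then show ?thesis
      unfolding r_def[symmetric] unfolding e_def[symmetric]
      by (simp only:) (simp add: algebra_simps)
  qed
  have sub: "((\<lambda>x. X i - x) has_derivative (\<lambda>y. - y)) (at x)"
    by (auto intro!: derivative_eq_intros)
  have "((\<lambda>x. inverse (dst X i x) *\<^sub>R (X i - x)) has_derivative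
      (\<lambda>y. - inverse (dst X i x) *\<^sub>R (y - (bearing X i x \<bullet> y) *\<^sub>R bearing X i x))) (at x)"
    by (rule has_derivative_eq_rhs, rule has_derivative_scaleR, rule inv, rule sub)
      (rule ext, rule scale)
  then show ?thesis
    by (simp only: b[symmetric])
qed

lemma cang_has_derivative:
  assumes "x \<noteq> X i"
  shows "(cang X xg i has_derivative (\<lambda>y. - inverse (dst X i x) *
    ((bearing X i xg - cang X xg i x *\<^sub>R bearing X i x) \<bullet> y))) (at x)"
proof -
  have "((\<lambda>x. bearing X i xg \<bullet> bearing X i x) has_derivative
    (\<lambda>y. bearing X i xg \<bullet> (- inverse (dst X i x) *\<^sub>R (y - (bearing X i x \<bullet> y) *\<^sub>R bearing X i x)))) (at x)"
    by (intro has_derivative_inner_right bearing_has_derivative assms)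
  then show ?thesis
    by (simp add: cang_def[abs_def] algebra_simps)
qed

lemma C2_region_differentiable:
  assumes "c \<in> C2_region f"
  shows "(f has_vector_derivative fdot f c) (at c within {-1..1})"
    and "(fdot f has_vector_derivative fddot f c) (at c within {-1..1})"
  using assms unfolding C2_region_def C2_on_def fdot_def fddot_def
  by (auto simp: vector_derivative_works)

text \<open>
  Continuity on each member of a family of relatively open sets passes to their union, because it is a
  local property.
\<close>

lemma C2_region_fddot_continuous:
  "continuous_on (C2_region f) (fddot f)"
proof (rule continuous_on_subset)
  let ?\<V> = "{V. openin (top_of_set {-1..1}) V \<and> C2_on f V}"
  show "continuous_on (\<Union>?\<V>) (fddot f)"
    unfolding continuous_on_eq_continuous_within
  proof
    fix c assume "c \<in> \<Union>?\<V>"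
    then obtain V where V: "c \<in> V" "openin (top_of_set {-1..1}) V" "continuous_on V (fddot f)"
      by (auto simp: C2_on_def)
    then obtain O' where O': "open O'" "V = {-1..1} \<inter> O'"
      by (auto simp: openin_open)
    have c: "c \<in> O'" using V(1) O'(2) by simp
    have "\<Union>?\<V> \<subseteq> {-1..1}"
      by (rule Sup_least, elim CollectE conjE, erule openin_imp_subset)
    then have "\<Union>?\<V> \<inter> O' \<subseteq> V" using O'(2) by blast
    moreover have "continuous (at c within V) (fddot f)"
      using V by (simp add: continuous_on_eq_continuous_within)
    ultimately have "continuous (at c within \<Union>?\<V> \<inter> O') (fddot f)"
      by (rule continuous_within_subset[rotated])
    moreover have "at c within \<Union>?\<V> \<inter> O' = at c within \<Union>?\<V>"
      using c O'(1) by (rule at_within_nhd) auto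
    ultimately show "continuous (at c within \<Union>?\<V>) (fddot f)" by simp
  qed
qed (simp add: C2_region_def)

text \<open>
  A derivative of \<open>h\<close> within \<open>{-1..1}\<close> is enough, because \<open>c\<^sub>i\<close> takes all its values in this interval;
  so the one-sided derivatives at \<open>\<plusminus>1\<close> are the correct ones for the chain rule.
\<close>

lemma compose_cang_has_derivative:
  assumes x: "x \<noteq> X i"
    and h: "(h has_vector_derivative h') (at (cang X xg i x) within {-1..1})"
  shows "((\<lambda>x. h (cang X xg i x)) has_derivative (\<lambda>y. (- inverse (dst X i x) *
    ((bearing X i xg - cang X xg i x *\<^sub>R bearing X i x) \<bullet> y)) *\<^sub>R h')) (at x)"
proof -
  have "(h has_derivative (\<lambda>s. s *\<^sub>R h')) (at (cang X xg i x) within {-1..1})"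
    using h by (simp add: has_vector_derivative_def)
  moreover have "cang X xg i ` UNIV \<subseteq> {-1..1}"
    by (rule image_subsetI, rule cang_bounds)
  ultimately have "(h has_derivative (\<lambda>s. s *\<^sub>R h')) (at (cang X xg i x) within cang X xg i ` UNIV)"
    by (rule has_derivative_subset)
  from has_derivative_in_compose[OF cang_has_derivative[of x X i xg, OF x] this]
  show ?thesis .
qed

lemma cost_gderiv:
  assumes "x \<in> regular_region N X xg f"
  shows "GDERIV (cost N X xg f) x :> - gfield N X xg f x"
  unfolding gderiv_def
proof -
  have "((\<lambda>x. dst X i x * f (cang X xg i x)) has_derivative
      (\<lambda>y. y \<bullet> - (f (cang X xg i x) *\<^sub>R bearing X i x
     + fdot f (cang X xg i x) *\<^sub>R (bearing X i xg - cang X xg i x *\<^sub>R bearing X i x)))) (at x)"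
    if i: "i \<in> {1..N}" for i
  proof -
    have x: "x \<noteq> X i" and c: "cang X xg i x \<in> C2_region f"
      using regular_regionD[OF assms i] by blast+
    have eq: "d * ((- inverse d * (r \<bullet> y)) *\<^sub>R f1) + - (b \<bullet> y) * f0 = y \<bullet> - (f0 *\<^sub>R b + f1 *\<^sub>R r)"
      if "d \<noteq> 0" for d f0 f1 and b r y :: "real^2"
    proof -
      have "d * ((- inverse d * (r \<bullet> y)) *\<^sub>R f1) = - (f1 * (r \<bullet> y))"
        using that by simp
      moreover have "y \<bullet> - (f0 *\<^sub>R b + f1 *\<^sub>R r) = - (f0 * (b \<bullet> y)) - f1 * (r \<bullet> y)"
        by (simp only: inner_minus_right inner_add_right inner_scaleR_right
            inner_commute[of y b] inner_commute[of y r])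
      ultimately show ?thesis by simp
    qed
    show ?thesis
      by (rule has_derivative_eq_rhs, rule has_derivative_mult, rule dst_has_derivative[of x X i, OF x],
          rule compose_cang_has_derivative[of x X i, OF x], rule C2_region_differentiable(1)[OF c])
        (rule ext, rule eq, use dst_pos[of x X i, OF x] in simp)
  qed
  then have "((\<lambda>x. \<Sum>i=1..N. dst X i x * f (cang X xg i x)) has_derivative
      (\<lambda>y. \<Sum>i=1..N. y \<bullet> - (f (cang X xg i x) *\<^sub>R bearing X i x
     + fdot f (cang X xg i x) *\<^sub>R (bearing X i xg - cang X xg i x *\<^sub>R bearing X i x)))) (at x)"
    by (rule has_derivative_sum)
  then show "(cost N X xg f has_derivative (\<lambda>h. h \<bullet> - gfield N X xg f x)) (at x)"
    by (simp only: cost_def[abs_def] gfield_def inner_sum_right[symmetric] sum_negf)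
qed

lemma negrad_eq_gfield:
  assumes "x \<in> regular_region N X xg f"
  shows "negrad N X xg f x = gfield N X xg f x"
proof -
  have "grad (cost N X xg f) x = - gfield N X xg f x"
    unfolding grad_def
  proof (rule the_equality)
    show "GDERIV (cost N X xg f) x :> - gfield N X xg f x"
      by (rule cost_gderiv[OF assms])
    fix D assume "GDERIV (cost N X xg f) x :> D"
    then have "(\<lambda>h. h \<bullet> D) = (\<lambda>h. h \<bullet> - gfield N X xg f x)"
      using cost_gderiv[OF assms] has_derivative_unique unfolding gderiv_def by blast
    then show "D = - gfield N X xg f x"
      by (metis vector_eq_ldot)
  qed
  then show ?thesis by (simp add: negrad_def)
qed

lemma outer_mult_vec: "outer u v *v y = (v \<bullet> y) *\<^sub>R u"
  by (simp add: vec_eq_iff outer_def matrix_vector_mult_def inner_vec_def sum_distrib_right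
      sum_distrib_left mult_ac)

lemma Hmat_mult_vec:
  fixes X :: "nat \<Rightarrow> real^2" and i :: nat and x y :: "real^2"
  defines "p \<equiv> y - (bearing X i x \<bullet> y) *\<^sub>R bearing X i x"
  shows "Hmat X xg f i x *v y =
    (fddot f (cang X xg i x) * (bearing X i xg \<bullet> p)) *\<^sub>R (cang X xg i x *\<^sub>R bearing X i x - bearing X i xg)
    + (fdot f (cang X xg i x) * cang X xg i x - f (cang X xg i x)) *\<^sub>R p"
proof -
  have "Pmat X i x *v y = p"
    by (simp add: Pmat_def p_def matrix_vector_mult_diff_rdistrib outer_mult_vec)
  then show ?thesis
    by (simp add: Hmat_def Let_def matrix_vector_mul_assoc[symmetric] matrix_vector_mult_add_rdistrib
        scaleR_matrix_vector_assoc[symmetric] outer_mult_vec)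
qed

text \<open>
  This is where the matrices \<open>H\<^sub>i\<close> come from. The derivatives of \<open>f (c\<^sub>i) \<beta>\<^sub>i\<close> and of the scalar
  \<open>c\<^sub>i\<close> inside \<open>\<beta>\<^sub>g\<^sub>i - c\<^sub>i \<beta>\<^sub>i\<close> produce two terms with \<open>f' (c\<^sub>i)\<close> along \<open>\<beta>\<^sub>i\<close> that cancel; the rest acts on
  the projection \<open>p\<close> of the direction orthogonal to \<open>\<beta>\<^sub>i\<close>.
\<close>

lemma gfield_has_derivative:
  assumes "x \<in> regular_region N X xg f"
  shows "(gfield N X xg f has_derivative
    (\<lambda>y. \<Sum>i=1..N. inverse (dst X i x) *\<^sub>R (Hmat X xg f i x *v y))) (at x)"
proof -
  have "((\<lambda>x. f (cang X xg i x) *\<^sub>R bearing X i x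
     + fdot f (cang X xg i x) *\<^sub>R (bearing X i xg - cang X xg i x *\<^sub>R bearing X i x)) has_derivative
      (\<lambda>y. inverse (dst X i x) *\<^sub>R (Hmat X xg f i x *v y))) (at x)"
    if i: "i \<in> {1..N}" for i
  proof -
    have x: "x \<noteq> X i" and c: "cang X xg i x \<in> C2_region f"
      using regular_regionD[OF assms i] by blast+
    note df = compose_cang_has_derivative[of x X i _ _ xg, OF x C2_region_differentiable(1)[OF c]]
    note ddf = compose_cang_has_derivative[of x X i _ _ xg, OF x C2_region_differentiable(2)[OF c]]
    note db = bearing_has_derivative[of x X i, OF x]
    note dc = cang_has_derivative[of x X i xg, OF x]
    have eq: "f c *\<^sub>R (- e *\<^sub>R (y - (b \<bullet> y) *\<^sub>R b)) + ((- e * ((bg - c *\<^sub>R b) \<bullet> y)) *\<^sub>R f1) *\<^sub>R b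
        + (f1 *\<^sub>R (0 - (c *\<^sub>R (- e *\<^sub>R (y - (b \<bullet> y) *\<^sub>R b)) + (- e * ((bg - c *\<^sub>R b) \<bullet> y)) *\<^sub>R b))
          + ((- e * ((bg - c *\<^sub>R b) \<bullet> y)) *\<^sub>R f2) *\<^sub>R (bg - c *\<^sub>R b))
      = e *\<^sub>R ((f2 * (bg \<bullet> (y - (b \<bullet> y) *\<^sub>R b))) *\<^sub>R (c *\<^sub>R b - bg) + (f1 * c - f c) *\<^sub>R (y - (b \<bullet> y) *\<^sub>R b))"
      if "bg \<bullet> b = c" for c e f1 f2 and b bg y :: "real^2"
    proof -
      define p where "p = y - (b \<bullet> y) *\<^sub>R b"
      define r where "r = (bg - c *\<^sub>R b) \<bullet> y"
      have "bg \<bullet> p = r"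
        using that by (simp add: p_def r_def inner_diff_right inner_diff_left mult.commute)
      then show ?thesis
        unfolding p_def[symmetric] r_def[symmetric] by (simp add: algebra_simps)
    qed
    show ?thesis
      by (rule has_derivative_eq_rhs, rule has_derivative_add, rule has_derivative_scaleR,
          rule df, rule db, rule has_derivative_scaleR, rule ddf, rule has_derivative_diff,
          rule has_derivative_const, rule has_derivative_scaleR, rule dc, rule db)
        (unfold Hmat_mult_vec, rule ext, rule eq, simp add: cang_def)
  qed
  then show ?thesis
    unfolding gfield_def[abs_def] by (rule has_derivative_sum)
qed

lemma continuous_on_bearing:
  "(\<And>x. x \<in> S \<Longrightarrow> x \<noteq> X i) \<Longrightarrow> continuous_on S (bearing X i)"
  by (intro continuous_at_imp_continuous_on ballI has_derivative_continuous[OF bearing_has_derivative])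

lemma continuous_on_cang:
  "(\<And>x. x \<in> S \<Longrightarrow> x \<noteq> X i) \<Longrightarrow> continuous_on S (cang X xg i)"
  by (intro continuous_at_imp_continuous_on ballI has_derivative_continuous[OF cang_has_derivative])

text \<open>
  The set \<open>C2_region f\<close> is only relatively open in \<open>{-1..1}\<close>, but \<open>c\<^sub>i\<close> never leaves this interval.
\<close>

lemma open_regular_region: "open (regular_region N X xg f)"
proof -
  have "openin (top_of_set {-1..1}) (C2_region f)"
    unfolding C2_region_def by (rule openin_Union) blast
  then obtain O' where O': "open O'" "C2_region f = {-1..1} \<inter> O'"
    by (auto simp: openin_open)
  have "open ({x. x \<noteq> X i} \<inter> cang X xg i -` O')" for i
  proof (rule continuous_open_preimage)
    show "continuous_on {x. x \<noteq> X i} (cang X xg i)"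
      by (rule continuous_on_cang) simp
    have "{x. x \<noteq> X i} = - {X i}" by auto
    then show "open {x. x \<noteq> X i}" by (simp add: open_Compl)
  qed (rule O'(1))
  moreover have "regular_region N X xg f = (\<Inter>i\<in>{1..N}. {x. x \<noteq> X i} \<inter> cang X xg i -` O')"
    using cang_bounds by (auto simp: regular_region_def O')
  ultimately show ?thesis by auto
qed

lemma continuous_on_regular_region:
  fixes N i :: nat and X :: "nat \<Rightarrow> real^2" and xg :: "real^2" and f :: "real \<Rightarrow> real"
  defines "W \<equiv> regular_region N X xg f"
  shows "continuous_on W (gfield N X xg f)"
    and "i \<in> {1..N} \<Longrightarrow> continuous_on W (\<lambda>x. inverse (dst X i x))"
    and "i \<in> {1..N} \<Longrightarrow> continuous_on (W \<times> UNIV) (\<lambda>p. Hmat X xg f i (fst p) *v snd p)"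
proof -
  show "continuous_on W (gfield N X xg f)"
    unfolding W_def
    by (intro continuous_at_imp_continuous_on ballI has_derivative_continuous[OF gfield_has_derivative])
  assume i: "i \<in> {1..N}"
  have W: "x \<noteq> X i" "cang X xg i x \<in> C2_region f" if "x \<in> W" for x
    using regular_regionD[OF _ i] that unfolding W_def by blast+
  then show "continuous_on W (\<lambda>x. inverse (dst X i x))"
    unfolding dst_def by (intro continuous_intros) auto
  have c: "continuous_on W (cang X xg i)" and b: "continuous_on W (bearing X i)"
    using continuous_on_cang[of W X i xg] continuous_on_bearing[of W X i] W(1) by blast+
  have "continuous_on W (\<lambda>x. h (cang X xg i x))"
    if h: "\<And>c. c \<in> C2_region f \<Longrightarrow> (h has_vector_derivative h' c) (at c within {-1..1})"
    for h h' :: "real \<Rightarrow> real"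
  proof (intro continuous_at_imp_continuous_on ballI)
    fix x assume x: "x \<in> W"
    show "isCont (\<lambda>x. h (cang X xg i x)) x"
      by (rule has_derivative_continuous, rule compose_cang_has_derivative[of x X i],
          rule W(1)[OF x], rule h, rule W(2)[OF x])
  qed
  note compose = this
  have fs: "continuous_on W (\<lambda>x. f (cang X xg i x))" "continuous_on W (\<lambda>x. fdot f (cang X xg i x))"
     apply (rule compose[of f], rule C2_region_differentiable, assumption)
     apply (rule compose[of "fdot f"], rule C2_region_differentiable, assumption)
    done
  have fdd: "continuous_on W (\<lambda>x. fddot f (cang X xg i x))"
    apply (rule continuous_on_compose2[OF C2_region_fddot_continuous c])
    using W(2) by auto
  have lift: "continuous_on (W \<times> (UNIV :: (real^2) set)) (\<lambda>p. u (fst p))"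
    if "continuous_on W u" for u :: "real^2 \<Rightarrow> 'a::topological_space"
    by (rule continuous_on_compose2[OF that continuous_on_fst[OF continuous_on_id]]) auto
  show "continuous_on (W \<times> UNIV) (\<lambda>p. Hmat X xg f i (fst p) *v snd p)"
    unfolding Hmat_mult_vec
    by (intro continuous_on_add continuous_on_scaleR continuous_on_mult continuous_on_diff
        continuous_on_inner continuous_on_const continuous_on_snd continuous_on_id
        lift[OF b] lift[OF c] lift[OF fs(1)] lift[OF fs(2)] lift[OF fdd])
qed

section \<open>Plane geometry of the heading\<close>

definition perp :: "real \<Rightarrow> real^2" where
  "perp \<theta> = vector [- sin \<theta>, cos \<theta>]"

lemma inner_real2: "u \<bullet> v = u $ 1 * v $ 1 + u $ 2 * v $ (2::2)" for u v :: "real^2"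
  by (simp add: inner_vec_def sum_2)

lemma heading_components [simp]: "heading \<theta> $ 1 = cos \<theta>" "heading \<theta> $ 2 = sin \<theta>"
  by (simp_all add: heading_def)

lemma perp_components [simp]: "perp \<theta> $ 1 = - sin \<theta>" "perp \<theta> $ 2 = cos \<theta>"
  by (simp_all add: perp_def)

lemma Smat_mult_vec [simp]: "(Smat *v u) $ 1 = u $ 2" "(Smat *v u) $ 2 = - u $ 1"
  by (simp_all add: Smat_def matrix_vector_mult_def sum_2)

lemma heading_perp_Pythagoras: "(heading \<theta> \<bullet> u)\<^sup>2 + (perp \<theta> \<bullet> u)\<^sup>2 = (norm u)\<^sup>2"
proof -
  have "(c * a + s * b)\<^sup>2 + (- s * a + c * b)\<^sup>2 = (c\<^sup>2 + s\<^sup>2) * (a * a + b * b)" for a b c s :: real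
    by (simp add: power2_eq_square algebra_simps)
  from this[of "cos \<theta>" "u $ 1" "sin \<theta>" "u $ 2"] show ?thesis
    by (simp add: dot_square_norm[symmetric] inner_real2)
qed

text \<open>
  The unicycle realises any velocity parallel to its heading, of either orientation.
\<close>

lemma heading_projection:
  assumes "perp \<theta> \<bullet> u = 0"
  shows "(heading \<theta> \<bullet> u) *\<^sub>R heading \<theta> = u"
proof -
  have "(c * a + s * b) * c = a \<and> (c * a + s * b) * s = b"
    if "c * b = s * a" "c * c + s * s = 1" for a b c s :: real
    using that by algebra
  from this[of "cos \<theta>" "u $ 2" "sin \<theta>" "u $ 1"] show ?thesis
    using assms by (simp add: inner_real2 vec_eq_iff forall_2)
qed

lemma vector2_eq: "(vector [a, b] :: real^2) = a *\<^sub>R axis 1 1 + b *\<^sub>R axis 2 1"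
  by (simp add: vec_eq_iff forall_2 axis_def)

lemma heading_has_derivative: "(heading has_derivative (\<lambda>s. s *\<^sub>R perp \<theta>)) (at \<theta>)"
proof -
  have "((\<lambda>\<theta>. cos \<theta> *\<^sub>R axis 1 1 + sin \<theta> *\<^sub>R axis 2 1) has_derivative
      (\<lambda>s. s *\<^sub>R (- sin \<theta> *\<^sub>R axis 1 1 + cos \<theta> *\<^sub>R (axis 2 1 :: real^2)))) (at \<theta>)"
    by (auto intro!: derivative_eq_intros simp: algebra_simps)
  then show ?thesis
    by (simp add: heading_def[abs_def] perp_def vector2_eq)
qed

lemma continuous_on_heading: "continuous_on S heading"
  by (intro continuous_at_imp_continuous_on ballI has_derivative_continuous[OF heading_has_derivative])

lemma continuous_on_perp: "continuous_on S perp"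
proof -
  have eq: "perp = (\<lambda>\<theta>. heading (\<theta> + pi / 2))"
    by (auto simp: fun_eq_iff vec_eq_iff forall_2 sin_add cos_add)
  show ?thesis
    unfolding eq by (rule continuous_on_compose2[OF continuous_on_heading[of UNIV]])
      (intro continuous_intros, simp)
qed

text \<open>
  Up to normalisation both sides are the derivative of the cosine of the angle between a fixed heading
  and a vector \<open>g\<close> that moves with velocity \<open>\<gamma>\<close>: the left side from the quotient rule, the right side from
  the chain rule, \<open>(g \<bullet> S \<gamma>) / \<parallel>g\<parallel>\<^sup>2\<close> being the angular velocity of \<open>g\<close>.
\<close>

lemma planar_angle_identity:
  "(heading \<theta> \<bullet> \<gamma>) * (norm g)\<^sup>2 - (heading \<theta> \<bullet> g) * (\<gamma> \<bullet> g) = - (perp \<theta> \<bullet> g) * (g \<bullet> (Smat *v \<gamma>))"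
  unfolding dot_square_norm[symmetric] inner_real2 by (simp add: algebra_simps)

text \<open>
  The factor in front is \<open>- sin \<theta>\<^sub>e\<close> and the bracket is the rate of change of \<open>\<theta>\<^sub>e\<close>, so this is the
  derivative of \<open>cos \<theta>\<^sub>e\<close> without mentioning the discontinuous function \<open>\<theta>\<^sub>e\<close>.
\<close>

lemma alignment_has_derivative:
  fixes g :: "'a::real_inner \<Rightarrow> real^2"
  assumes g: "(g has_derivative g') (at (fst z))" and nz: "g (fst z) \<noteq> 0"
  shows "((\<lambda>z. heading (snd z) \<bullet> g (fst z) / norm (g (fst z))) has_derivative
    (\<lambda>v. perp (snd z) \<bullet> g (fst z) / norm (g (fst z)) *
      (snd v - (g (fst z) \<bullet> (Smat *v g' (fst v))) / (norm (g (fst z)))\<^sup>2))) (at z)"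
proof -
  define G where "G = g (fst z)"
  have n: "norm G > 0" using nz by (simp add: G_def)
  have "(fst has_derivative fst) (at z)" "(snd has_derivative snd) (at z)"
    by (auto intro: derivative_intros)
  then have dg: "((\<lambda>z. g (fst z)) has_derivative (\<lambda>v. g' (fst v))) (at z)"
    and dh: "((\<lambda>z. heading (snd z)) has_derivative (\<lambda>v. snd v *\<^sub>R perp (snd z))) (at z)"
    using g heading_has_derivative by (auto intro: has_derivative_compose)
  have dn: "((\<lambda>z. norm (g (fst z))) has_derivative (\<lambda>v. g' (fst v) \<bullet> sgn G)) (at z)"
    unfolding G_def by (rule has_derivative_compose[OF dg has_derivative_norm[OF nz]])
  have alg: "((heading (snd z) \<bullet> \<gamma> + (s *\<^sub>R perp (snd z)) \<bullet> G) * norm G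
      - heading (snd z) \<bullet> G * (\<gamma> \<bullet> sgn G)) / (norm G * norm G)
      = perp (snd z) \<bullet> G / norm G * (s - (G \<bullet> (Smat *v \<gamma>)) / (norm G)\<^sup>2)" (is "?L = ?R") for s \<gamma>
  proof -
    have "?L = (s * (perp (snd z) \<bullet> G)) / norm G
        + ((heading (snd z) \<bullet> \<gamma>) * (norm G)\<^sup>2 - (heading (snd z) \<bullet> G) * (\<gamma> \<bullet> G)) / (norm G) ^ 3"
      using n by (simp add: sgn_div_norm field_simps power2_eq_square power3_eq_cube)
    also have "\<dots> = ?R"
      unfolding planar_angle_identity using n
      by (simp add: field_simps power2_eq_square power3_eq_cube)
    finally show ?thesis .
  qed
  have "((\<lambda>z. heading (snd z) \<bullet> g (fst z) / norm (g (fst z))) has_derivative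
     (\<lambda>v. ((heading (snd z) \<bullet> g' (fst v) + (snd v *\<^sub>R perp (snd z)) \<bullet> G) * norm G
      - heading (snd z) \<bullet> G * (g' (fst v) \<bullet> sgn G)) / (norm G * norm G))) (at z)"
    unfolding G_def
    by (rule has_derivative_divide'[OF has_derivative_inner[OF dh dg] dn[unfolded G_def]]) (use nz in simp)
  then show ?thesis
    unfolding alg unfolding G_def .
qed

section \<open>The feedback law\<close>

lemma control_region_altdef:
  "control_region N X xg f = {x \<in> regular_region N X xg f. gfield N X xg f x \<noteq> 0}"
proof -
  have "x \<in> control_region N X xg f \<longleftrightarrow> x \<in> regular_region N X xg f \<and> negrad N X xg f x \<noteq> 0" for x
    unfolding control_region_def regular_region_def negrad_def by auto
  then show ?thesis
    by (simp add: set_eq_iff negrad_eq_gfield cong: conj_cong)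
qed

lemma control_regionD:
  assumes "x \<in> control_region N X xg f"
  shows "x \<in> regular_region N X xg f" "gfield N X xg f x \<noteq> 0" "negrad N X xg f x = gfield N X xg f x"
  using assms by (simp_all add: control_region_altdef negrad_eq_gfield)

lemma open_control_region: "open (control_region N X xg f)"
proof -
  have "control_region N X xg f = regular_region N X xg f \<inter> gfield N X xg f -` (- {0})"
    by (simp add: set_eq_iff control_region_altdef)
  then show ?thesis
    using continuous_open_preimage[OF continuous_on_regular_region(1) open_regular_region, of "- {0}"]
    by (simp add: open_Compl)
qed

text \<open>
  The sine removes the reduction modulo \<open>2 \<pi>\<close> and the branch of the argument; it connects the
  switching variable with the continuous quantity \<open>perp \<theta> \<bullet> g\<close>.
\<close>

lemma sin_theta_e:
  assumes "negrad N X xg f x \<noteq> 0"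
  shows "norm (negrad N X xg f x) * sin (theta_e N X xg f (x, \<theta>)) = - (perp \<theta> \<bullet> negrad N X xg f x)"
proof -
  define g where "g = negrad N X xg f x"
  define t where "t = theta_d N X xg f x"
  define k where "k = \<lfloor>(\<theta> - t + pi) / \<bar>2 * pi\<bar>\<rfloor>"
  have "theta_e N X xg f (x, \<theta>) = (\<theta> - t) - (2 * pi) * of_int k"
    by (simp add: theta_e_def rmod_def k_def t_def)
  then have "sin (theta_e N X xg f (x, \<theta>)) = sin (\<theta> - t)"
    by (simp add: sin_diff sin_int_2pin cos_int_2pin)
  moreover have "norm g * cos t = g $ 1" "norm g * sin t = g $ 2"
  proof -
    let ?z = "Complex (g $ 1) (g $ 2)"
    have "cmod ?z = norm g"
      by (simp add: cmod_def norm_eq_sqrt_inner inner_real2 power2_eq_square)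
    moreover have "rcis (cmod ?z) (Arg ?z) = ?z"
      by (rule rcis_cmod_Arg)
    ultimately show "norm g * cos t = g $ 1" "norm g * sin t = g $ 2"
      by (simp_all add: complex_eq_iff t_def theta_d_def arctan2_def g_def)
  qed
  moreover have "norm g * sin (\<theta> - t) = sin \<theta> * (norm g * cos t) - cos \<theta> * (norm g * sin t)"
    by (simp add: sin_diff algebra_simps)
  ultimately show ?thesis
    by (simp add: g_def[symmetric] inner_real2)
qed

lemma theta_e_range: "theta_e N X xg f z \<in> {-pi..<pi}"
  using rmod_less[of "2 * pi"] rmod_nonneg[of "2 * pi"]
  by (auto simp: theta_e_def split: prod.split)

lemma theta_e_sign:
  assumes "x \<in> control_region N X xg f"
  shows "perp \<theta> \<bullet> gfield N X xg f x < 0 \<Longrightarrow> 0 < theta_e N X xg f (x, \<theta>)"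
    and "0 < perp \<theta> \<bullet> gfield N X xg f x \<Longrightarrow> theta_e N X xg f (x, \<theta>) < 0"
proof -
  let ?t = "theta_e N X xg f (x, \<theta>)" and ?g = "gfield N X xg f x"
  have n: "0 < norm ?g" and eq: "norm ?g * sin ?t = - (perp \<theta> \<bullet> ?g)"
    using control_regionD[OF assms] sin_theta_e[of N X xg f x \<theta>] by auto
  have r: "-pi \<le> ?t" "?t < pi"
    using theta_e_range[of N X xg f "(x, \<theta>)"] by auto
  {
    assume "perp \<theta> \<bullet> ?g < 0"
    then have "0 < sin ?t"
      using eq n by (smt (verit, best) zero_less_mult_pos)
    moreover have "sin ?t \<le> 0" if "?t \<le> 0"
      using sin_ge_zero[of "- ?t"] r that by simp
    ultimately show "0 < ?t" by force
  next
    assume "0 < perp \<theta> \<bullet> ?g"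
    then have "sin ?t < 0"
      using eq n by (smt (verit, best) mult_nonneg_nonneg)
    moreover have "0 \<le> sin ?t" if "0 \<le> ?t"
      using sin_ge_zero[of ?t] r that by simp
    ultimately show "?t < 0" by force
  }
qed

text \<open>
  Sums over the coefficients of one sign, scaled by the common bound \<open>\<rho>\<close> of the weights, dominate the
  weighted sum. With \<open>r i = d\<^sub>i\<inverse>\<close> this sum is the angular velocity of the gradient direction.
\<close>

lemma angular_rate_bound:
  fixes r :: "'i \<Rightarrow> real"
  assumes "finite I" and r: "\<And>i. i \<in> I \<Longrightarrow> 0 < r i \<and> r i < \<rho>"
  shows "(\<Sum>i\<in>I. r i * a i) \<le> \<rho> * (\<Sum>i\<in>I. max (a i) 0)"
    and "\<rho> * (\<Sum>i\<in>I. min (a i) 0) \<le> (\<Sum>i\<in>I. r i * a i)"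
proof -
  have "r i * a i \<le> \<rho> * max (a i) 0 \<and> \<rho> * min (a i) 0 \<le> r i * a i" if "i \<in> I" for i
    using r[OF that]
    by (cases "0 \<le> a i") (auto simp: mult_right_mono mult_right_mono_neg mult_nonneg_nonpos)
  then show "(\<Sum>i\<in>I. r i * a i) \<le> \<rho> * (\<Sum>i\<in>I. max (a i) 0)"
    and "\<rho> * (\<Sum>i\<in>I. min (a i) 0) \<le> (\<Sum>i\<in>I. r i * a i)"
    by (auto simp: sum_distrib_left intro: sum_mono)
qed

text \<open>
  Writing the sums with \<open>max\<close> and \<open>min\<close> shows that each branch of the feedback is continuous although the
  sets of indices jump.
\<close>

lemma omega_eq:
  "omega N X xg f \<rho> k z =
    (if theta_e N X xg f z \<le> 0
     then \<rho> * (\<Sum>i=1..N. max (acoef N X xg f i z) 0) + k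
     else \<rho> * (\<Sum>i=1..N. min (acoef N X xg f i z) 0) - k)"
proof -
  have pos: "(\<Sum>i | i \<in> {1..N} \<and> a i > 0. a i) = (\<Sum>i=1..N. max (a i) 0)" for a :: "nat \<Rightarrow> real"
  proof -
    have "(\<Sum>i | i \<in> {1..N} \<and> a i > 0. a i) = (\<Sum>i\<in>{1..N}. if a i > 0 then a i else 0)"
      by (rule sum.inter_filter) simp
    also have "\<dots> = (\<Sum>i=1..N. max (a i) 0)"
      by (rule sum.cong) simp_all
    finally show ?thesis .
  qed
  have neg: "(\<Sum>i | i \<in> {1..N} \<and> a i < 0. a i) = (\<Sum>i=1..N. min (a i) 0)" for a :: "nat \<Rightarrow> real"
  proof -
    have "(\<Sum>i | i \<in> {1..N} \<and> a i < 0. a i) = (\<Sum>i\<in>{1..N}. if a i < 0 then a i else 0)"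
      by (rule sum.inter_filter) simp
    also have "\<dots> = (\<Sum>i=1..N. min (a i) 0)"
      by (rule sum.cong) simp_all
    finally show ?thesis .
  qed
  show ?thesis
    unfolding omega_def pos neg ..
qed

lemma continuous_on_control_region:
  fixes N i :: nat and X :: "nat \<Rightarrow> real^2" and xg :: "real^2" and f :: "real \<Rightarrow> real"
  defines "D \<equiv> control_region N X xg f \<times> (UNIV :: real set)"
  shows "continuous_on D (\<lambda>z. gfield N X xg f (fst z))"
    and "continuous_on D (xvel N X xg f)"
    and "i \<in> {1..N} \<Longrightarrow> continuous_on D (acoef N X xg f i)"
proof -
  have D: "fst ` D \<subseteq> regular_region N X xg f" "\<And>z. z \<in> D \<Longrightarrow> gfield N X xg f (fst z) \<noteq> 0"
    using control_regionD unfolding D_def by fastforce+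
  have neg: "negrad N X xg f x = gfield N X xg f x" if "(x, \<theta>) \<in> D" for x \<theta>
    using that unfolding D_def by (simp add: control_regionD(3))
  show g: "continuous_on D (\<lambda>z. gfield N X xg f (fst z))"
    by (rule continuous_on_compose2[OF continuous_on_regular_region(1) _ D(1)])
      (intro continuous_intros)
  have h: "continuous_on D (\<lambda>z. heading (snd z))"
    by (rule continuous_on_compose2[OF continuous_on_heading[of UNIV]]) (intro continuous_intros, simp)
  have "continuous_on D (\<lambda>z. (heading (snd z) \<bullet> gfield N X xg f (fst z)) *\<^sub>R heading (snd z))"
    by (intro continuous_on_scaleR continuous_on_inner h g)
  then show v: "continuous_on D (xvel N X xg f)"
    by (rule continuous_on_eq) (clarsimp simp: xvel_def nu_def, simp add: neg)
  assume i: "i \<in> {1..N}"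
  have "continuous_on D (\<lambda>z. (fst z, xvel N X xg f z))"
    by (intro continuous_on_Pair continuous_on_fst continuous_on_id v)
  moreover have "(\<lambda>z. (fst z, xvel N X xg f z)) ` D \<subseteq> regular_region N X xg f \<times> UNIV"
    using D(1) by auto
  ultimately have "continuous_on D (\<lambda>z. Hmat X xg f i (fst z) *v xvel N X xg f z)"
    using continuous_on_compose2[OF continuous_on_regular_region(3)[OF i]] by fastforce
  then have "continuous_on D (\<lambda>z. Smat *v (Hmat X xg f i (fst z) *v xvel N X xg f z))"
    by (intro linear_continuous_on_compose[OF _ matrix_vector_mul_linear])
  then have "continuous_on D (\<lambda>z. (gfield N X xg f (fst z) \<bullet>
      (Smat *v (Hmat X xg f i (fst z) *v xvel N X xg f z))) / (norm (gfield N X xg f (fst z)))\<^sup>2)"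
    using D(2) by (intro continuous_on_divide continuous_on_inner continuous_on_power
        continuous_on_norm g) auto
  then show "continuous_on D (acoef N X xg f i)"
    by (rule continuous_on_eq) (clarsimp simp: acoef_def Let_def, simp add: neg)
qed

text \<open>
  Off the set where heading and gradient are parallel, the sign of \<open>perp \<theta> \<bullet> g\<close> is locally constant
  and selects one branch of the feedback.
\<close>

lemma closed_loop_continuous_off_alignment:
  fixes N :: nat and X :: "nat \<Rightarrow> real^2" and xg :: "real^2" and f :: "real \<Rightarrow> real"
  defines "D \<equiv> control_region N X xg f \<times> (UNIV :: real set)"
  assumes z: "z \<in> D" and q: "perp (snd z) \<bullet> gfield N X xg f (fst z) \<noteq> 0"
  shows "continuous (at z within D) (closed_loop N X xg f \<rho> k)"
proof -
  let ?q = "\<lambda>z. perp (snd z) \<bullet> gfield N X xg f (fst z)"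
  have D: "open D"
    unfolding D_def by (intro open_Times open_control_region open_UNIV)
  note cont = continuous_on_control_region[where N = N and X = X and xg = xg and f = f, folded D_def]
  have "continuous_on D (\<lambda>z. perp (snd z))"
    by (rule continuous_on_compose2[OF continuous_on_perp[of UNIV]]) (intro continuous_intros, simp)
  then have q_cont: "continuous_on D ?q"
    by (intro continuous_on_inner cont(1))
  have side: "continuous (at z within D) (closed_loop N X xg f \<rho> k)"
    if U: "open U" "?q z \<in> U" and w: "continuous_on D w"
      and eq: "\<And>y. y \<in> D \<Longrightarrow> ?q y \<in> U \<Longrightarrow> omega N X xg f \<rho> k y = w y" for U w
  proof -
    let ?S = "D \<inter> ?q -` U"
    have S: "open ?S" "z \<in> ?S"
      using continuous_open_preimage[OF q_cont D U(1)] z U(2) by auto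
    have "continuous_on ?S (\<lambda>z. (xvel N X xg f z, w z))"
      by (rule continuous_on_subset[of D]) (intro continuous_on_Pair cont(2) w, blast)
    then have "continuous_on ?S (closed_loop N X xg f \<rho> k)"
      by (rule continuous_on_eq) (simp add: closed_loop_def eq)
    then have "isCont (closed_loop N X xg f \<rho> k) z"
      using S continuous_on_eq_continuous_at by blast
    then show ?thesis
      by (rule continuous_at_imp_continuous_at_within)
  qed
  have theta: "?q y < 0 \<Longrightarrow> 0 < theta_e N X xg f y" "0 < ?q y \<Longrightarrow> theta_e N X xg f y < 0"
    if "y \<in> D" for y
    using theta_e_sign[of "fst y" N X xg f "snd y"] that by (auto simp: D_def)
  consider "?q z < 0" | "?q z > 0" using q by linarith
  then show ?thesis
  proof cases
    case 1
    show ?thesis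
    proof (rule side[of "{..<0}"])
      show "continuous_on D (\<lambda>z. \<rho> * (\<Sum>i=1..N. min (acoef N X xg f i z) 0) - k)"
        by (intro continuous_on_diff continuous_on_mult continuous_on_sum continuous_on_min
            continuous_on_const cont(3))
      fix y assume "y \<in> D" "?q y \<in> {..<0}"
      then show "omega N X xg f \<rho> k y = \<rho> * (\<Sum>i=1..N. min (acoef N X xg f i y) 0) - k"
        using theta(1)[of y] by (simp add: omega_eq)
    qed (use 1 in simp_all)
  next
    case 2
    show ?thesis
    proof (rule side[of "{0<..}"])
      show "continuous_on D (\<lambda>z. \<rho> * (\<Sum>i=1..N. max (acoef N X xg f i z) 0) + k)"
        by (intro continuous_on_add continuous_on_mult continuous_on_sum continuous_on_max
            continuous_on_const cont(3))
      fix y assume "y \<in> D" "?q y \<in> {0<..}"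
      then show "omega N X xg f \<rho> k y = \<rho> * (\<Sum>i=1..N. max (acoef N X xg f i y) 0) + k"
        using theta(2)[of y] by (simp add: omega_eq)
    qed (use 2 in simp_all)
  qed
qed

section \<open>The cosine of the angle error along Filippov solutions\<close>

definition cos_error ::
    "nat \<Rightarrow> (nat \<Rightarrow> real^2) \<Rightarrow> real^2 \<Rightarrow> (real \<Rightarrow> real) \<Rightarrow> (real^2) \<times> real \<Rightarrow> real" where
  "cos_error N X xg f z = heading (snd z) \<bullet> gfield N X xg f (fst z) / norm (gfield N X xg f (fst z))"

definition cos_error_deriv ::
    "nat \<Rightarrow> (nat \<Rightarrow> real^2) \<Rightarrow> real^2 \<Rightarrow> (real \<Rightarrow> real) \<Rightarrow> (real^2) \<times> real \<Rightarrow> (real^2) \<times> real \<Rightarrow> real" where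
  "cos_error_deriv N X xg f z v =
    perp (snd z) \<bullet> gfield N X xg f (fst z) / norm (gfield N X xg f (fst z)) *
      (snd v - (gfield N X xg f (fst z) \<bullet>
        (Smat *v (\<Sum>i=1..N. inverse (dst X i (fst z)) *\<^sub>R (Hmat X xg f i (fst z) *v fst v)))) /
          (norm (gfield N X xg f (fst z)))\<^sup>2)"

lemma cos_error_has_derivative:
  assumes "z \<in> control_region N X xg f \<times> UNIV"
  shows "(cos_error N X xg f has_derivative cos_error_deriv N X xg f z) (at z)"
proof -
  have "fst z \<in> control_region N X xg f" using assms by auto
  note r = control_regionD[OF this]
  show ?thesis
    unfolding cos_error_def[abs_def] cos_error_deriv_def[abs_def]
    by (rule alignment_has_derivative[OF gfield_has_derivative[OF r(1)] r(2)])
qed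

text \<open>
  Together with \<open>cos_error_has_derivative\<close> this makes \<open>cos_error\<close> a \<open>C\<^sup>1\<close> function on the control
  region, so that it is absolutely continuous along trajectories.
\<close>

lemma continuous_on_cos_error_deriv:
  "continuous_on (control_region N X xg f \<times> UNIV) (\<lambda>z. cos_error_deriv N X xg f z v)"
proof -
  let ?D = "control_region N X xg f \<times> (UNIV :: real set)"
  note g = continuous_on_control_region(1)[of N X xg f]
  have D: "fst ` ?D \<subseteq> regular_region N X xg f"
    using control_regionD(1) by auto
  have nz: "gfield N X xg f (fst z) \<noteq> 0" if "z \<in> ?D" for z
    using that control_regionD(2) by auto
  have p: "continuous_on ?D (\<lambda>z. perp (snd z))"
    by (rule continuous_on_compose2[OF continuous_on_perp[of UNIV]]) (intro continuous_intros, simp)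
  have d: "continuous_on ?D (\<lambda>z. inverse (dst X i (fst z)))" if "i \<in> {1..N}" for i
    by (rule continuous_on_compose2[OF continuous_on_regular_region(2)[OF that] _ D])
      (intro continuous_intros)
  have H: "continuous_on ?D (\<lambda>z. Hmat X xg f i (fst z) *v fst v)" if "i \<in> {1..N}" for i
  proof -
    have "continuous_on ?D (\<lambda>z. (fst z, fst v))"
      by (intro continuous_on_Pair continuous_on_fst continuous_on_id continuous_on_const)
    moreover have "(\<lambda>z. (fst z, fst v)) ` ?D \<subseteq> regular_region N X xg f \<times> UNIV"
      using D by auto
    ultimately show ?thesis
      using continuous_on_compose2[OF continuous_on_regular_region(3)[OF that]] by fastforce
  qed
  have "continuous_on ?D (\<lambda>z. Smat *v (\<Sum>i=1..N. inverse (dst X i (fst z)) *\<^sub>R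
      (Hmat X xg f i (fst z) *v fst v)))"
    by (intro linear_continuous_on_compose[OF _ matrix_vector_mul_linear] continuous_on_sum
        continuous_on_scaleR d H)
  then show ?thesis
    unfolding cos_error_deriv_def
    by (intro continuous_on_mult continuous_on_divide continuous_on_diff continuous_on_inner
        continuous_on_norm continuous_on_power continuous_on_const p g) (simp_all add: nz)
qed

lemma sqrt_one_minus_cos_error:
  assumes "z \<in> control_region N X xg f \<times> UNIV"
  shows "sqrt (1 - (cos_error N X xg f z)\<^sup>2)
      = \<bar>perp (snd z) \<bullet> gfield N X xg f (fst z)\<bar> / norm (gfield N X xg f (fst z))"
    and "(cos_error N X xg f z)\<^sup>2 \<le> 1"
proof -
  let ?g = "gfield N X xg f (fst z)"
  have n: "norm ?g > 0" using assms control_regionD(2)[of "fst z"] by auto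
  have "1 - (cos_error N X xg f z)\<^sup>2 = ((norm ?g)\<^sup>2 - (heading (snd z) \<bullet> ?g)\<^sup>2) / (norm ?g)\<^sup>2"
    using n by (simp add: cos_error_def power_divide diff_divide_distrib)
  also have "\<dots> = (perp (snd z) \<bullet> ?g / norm ?g)\<^sup>2"
    using heading_perp_Pythagoras[of "snd z" ?g] by (simp add: power_divide)
  finally have eq: "1 - (cos_error N X xg f z)\<^sup>2 = (perp (snd z) \<bullet> ?g / norm ?g)\<^sup>2" .
  show "sqrt (1 - (cos_error N X xg f z)\<^sup>2) = \<bar>perp (snd z) \<bullet> ?g\<bar> / norm ?g"
    unfolding eq by simp
  show "(cos_error N X xg f z)\<^sup>2 \<le> 1"
    using eq zero_le_power2[of "perp (snd z) \<bullet> ?g / norm ?g"] by linarith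
qed

text \<open>
  The key estimate. If heading and gradient are parallel, both sides vanish for every \<open>v\<close>. Otherwise
  \<open>v\<close> is the value of the vector field, and the feedback overcomes the rotation of the
  gradient direction by at least \<open>k\<close>, in the direction that increases the cosine.
\<close>

lemma cos_error_rate:
  fixes N :: nat and X :: "nat \<Rightarrow> real^2" and xg :: "real^2" and f :: "real \<Rightarrow> real"
  defines "D \<equiv> control_region N X xg f \<times> (UNIV :: real set)"
  assumes z: "z \<in> D" and gain: "\<And>i. i \<in> {1..N} \<Longrightarrow> inverse (dst X i (fst z)) < \<rho>"
    and v: "v \<in> filippov_map D (closed_loop N X xg f \<rho> k) z"
  shows "k * sqrt (1 - (cos_error N X xg f z)\<^sup>2) \<le> cos_error_deriv N X xg f z v"
proof -
  define g where "g = gfield N X xg f (fst z)"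
  define q where "q = perp (snd z) \<bullet> g"
  define a where "a i = acoef N X xg f i z" for i
  define r where "r i = inverse (dst X i (fst z))" for i
  have x: "fst z \<in> control_region N X xg f" using z by (auto simp: D_def)
  note reg = control_regionD[OF x]
  have n: "norm g > 0" using reg(2) by (simp add: g_def)
  have sq: "sqrt (1 - (cos_error N X xg f z)\<^sup>2) = \<bar>q\<bar> / norm g"
    using sqrt_one_minus_cos_error(1)[of z] z by (simp add: D_def q_def g_def)
  show ?thesis
  proof (cases "q = 0")
    case True
    then show ?thesis
      unfolding sq by (simp add: cos_error_deriv_def q_def g_def)
  next
    case False
    have "continuous (at z within D) (\<lambda>y. id (closed_loop N X xg f \<rho> k y))"
      using closed_loop_continuous_off_alignment[of z N X xg f \<rho> k] z False
      by (simp add: D_def q_def g_def)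
    from filippov_map_continuous_part[OF bounded_linear_ident[folded id_def] this v]
    have v_eq: "v = (xvel N X xg f z, omega N X xg f \<rho> k z)"
      by (simp add: closed_loop_def)
    have "(g \<bullet> (Smat *v (\<Sum>i=1..N. r i *\<^sub>R (Hmat X xg f i (fst z) *v xvel N X xg f z)))) / (norm g)\<^sup>2
        = (\<Sum>i=1..N. r i * ((g \<bullet> (Smat *v (Hmat X xg f i (fst z) *v xvel N X xg f z))) / (norm g)\<^sup>2))"
      by (simp add: linear_sum[OF matrix_vector_mul_linear] matrix_vector_mult_scaleR
          inner_sum_right sum_divide_distrib)
    also have "\<dots> = (\<Sum>i=1..N. r i * a i)"
      using reg(3) by (cases z) (simp add: a_def acoef_def Let_def g_def)
    finally have rate: "cos_error_deriv N X xg f z v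
        = q / norm g * (omega N X xg f \<rho> k z - (\<Sum>i=1..N. r i * a i))"
      by (simp add: cos_error_deriv_def v_eq q_def g_def r_def)
    have r: "0 < r i \<and> r i < \<rho>" if "i \<in> {1..N}" for i
      using gain[OF that] regular_regionD(1)[OF reg(1) that] dst_pos[of "fst z" X i]
      by (simp add: r_def)
    note bound = angular_rate_bound[of "{1..N}" r \<rho> a, OF _ r]
    note sign = theta_e_sign[OF x, of "snd z", folded g_def q_def]
    show ?thesis
    proof (cases "q < 0")
      case True
      then have "omega N X xg f \<rho> k z - (\<Sum>i=1..N. r i * a i) \<le> - k"
        using sign(1) bound(2) by (simp add: omega_eq a_def)
      then have "q / norm g * (- k) \<le> q / norm g * (omega N X xg f \<rho> k z - (\<Sum>i=1..N. r i * a i))"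
        using True n by (intro mult_left_mono_neg) (simp_all add: divide_le_0_iff)
      then show ?thesis
        unfolding sq rate using True by (simp add: mult.commute)
    next
      case False
      then have "q > 0" using \<open>q \<noteq> 0\<close> by simp
      then have "k \<le> omega N X xg f \<rho> k z - (\<Sum>i=1..N. r i * a i)"
        using sign(2) bound(1) by (simp add: omega_eq a_def)
      then have "q / norm g * k \<le> q / norm g * (omega N X xg f \<rho> k z - (\<Sum>i=1..N. r i * a i))"
        using \<open>q > 0\<close> n by (intro mult_left_mono) simp_all
      then show ?thesis
        unfolding sq rate using \<open>q > 0\<close> by (simp add: mult.commute)
    qed
  qed
qed

text \<open>
  Only the turning rate switches; the translational velocity is continuous in the state.
\<close>

lemma filippov_map_velocity:
  fixes N :: nat and X :: "nat \<Rightarrow> real^2" and xg :: "real^2" and f :: "real \<Rightarrow> real"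
  defines "D \<equiv> control_region N X xg f \<times> (UNIV :: real set)"
  assumes z: "z \<in> D" and v: "v \<in> filippov_map D (closed_loop N X xg f \<rho> k) z"
  shows "fst v = xvel N X xg f z"
proof -
  have "continuous (at z within D) (\<lambda>y. fst (closed_loop N X xg f \<rho> k y))"
    using continuous_on_control_region(2)[of N X xg f, folded D_def] z
    unfolding continuous_on_eq_continuous_within by (simp only: closed_loop_def fst_conv)
  from filippov_map_continuous_part[OF bounded_linear_fst this v] show ?thesis
    by (simp add: closed_loop_def)
qed

text \<open>
  Both values \<open>\<plusminus>1\<close> of the cosine are covered: pointing against the gradient flow, the unicycle moves
  along it in reverse.
\<close>

lemma xvel_eq_gfield:
  assumes "(x, \<theta>) \<in> control_region N X xg f \<times> UNIV" and "(cos_error N X xg f (x, \<theta>))\<^sup>2 = 1"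
  shows "xvel N X xg f (x, \<theta>) = gfield N X xg f x"
proof -
  have x: "x \<in> control_region N X xg f" using assms(1) by simp
  have "\<bar>perp \<theta> \<bullet> gfield N X xg f x\<bar> / norm (gfield N X xg f x) = 0"
    using sqrt_one_minus_cos_error(1)[OF assms(1)] assms(2) by simp
  then have "perp \<theta> \<bullet> gfield N X xg f x = 0"
    using control_regionD(2)[OF x] by simp
  then show ?thesis
    using heading_projection control_regionD(3)[OF x] by (simp add: xvel_def nu_def)
qed

section \<open>Finite-time convergence to the gradient flow\<close>

theorem theorem4p1:
  fixes N :: nat and X :: "nat \<Rightarrow> real^2" and xg :: "real^2" and f :: "real \<Rightarrow> real"
    and \<rho> k\<theta> :: real and x :: "real \<Rightarrow> real^2" and \<theta> :: "real \<Rightarrow> real"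
  assumes "\<And>i. i \<in> {1..N} \<Longrightarrow> xg \<noteq> X i"
    and "\<rho> > 0" and "k\<theta> > 0"
    and "filippov_solution (control_region N X xg f \<times> UNIV) (closed_loop N X xg f \<rho> k\<theta>)
           (\<lambda>t. (x t, \<theta> t))"
    and "\<And>i t. i \<in> {1..N} \<Longrightarrow> t \<ge> 0 \<Longrightarrow> inverse (dst X i (x t)) < \<rho>"
  shows "\<exists>T\<ge>0. \<forall>t>T. (x has_vector_derivative - grad (cost N X xg f) (x t)) (at t)"
proof -
  define D where "D = control_region N X xg f \<times> (UNIV :: real set)"
  define z where "z t = (x t, \<theta> t)" for t
  define w where "w t = cos_error N X xg f (z t)" for t
  let ?F = "closed_loop N X xg f \<rho> k\<theta>"
  have zD: "\<And>t. t \<ge> 0 \<Longrightarrow> z t \<in> D"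
    and ac: "\<And>b. b \<ge> 0 \<Longrightarrow> abs_continuous_on {0..b} z"
    and ae: "AE t in lebesgue_on {0..}.
        \<exists>v\<in>filippov_map D ?F (z t). (z has_vector_derivative v) (at t within {0..})"
    using assms(4) unfolding filippov_solution_def D_def z_def[abs_def] by auto
  have "AE t in lebesgue. t \<in> {0..} \<longrightarrow>
      (\<exists>v\<in>filippov_map D ?F (z t). (z has_vector_derivative v) (at t within {0..}))"
    using ae by (subst (asm) AE_restrict_space_iff) simp_all
  then obtain E where E: "E \<in> null_sets lebesgue"
    and sol: "\<And>t. t \<notin> E \<Longrightarrow> t \<ge> 0 \<Longrightarrow>
      \<exists>v\<in>filippov_map D ?F (z t). (z has_vector_derivative v) (at t within {0..})"
    by (rule AE_E3) auto
  have neg: "negligible E"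
    using E by (simp add: negligible_iff_null_sets)
  have openD: "open D"
    unfolding D_def by (intro open_Times open_control_region open_UNIV)
  obtain T where T: "T \<ge> 0" "(\<forall>t\<ge>T. w t = -1) \<or> (\<forall>t\<ge>T. w t = 1)"
  proof (rule finite_time_saturation[of w E k\<theta>])
    show "abs_continuous_on {0..b} w" if "b \<ge> 0" for b
      unfolding w_def
    proof (rule abs_continuous_on_C1_compose[OF openD _ _ ac[OF that]])
      show "(cos_error N X xg f has_derivative cos_error_deriv N X xg f y) (at y)" if "y \<in> D" for y
        by (rule cos_error_has_derivative[OF that[unfolded D_def]])
      show "continuous_on D (\<lambda>y. cos_error_deriv N X xg f y e)" for e
        unfolding D_def by (rule continuous_on_cos_error_deriv)
      show "z ` {0..b} \<subseteq> D"
        using zD by auto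
    qed
    show "-1 \<le> w t \<and> w t \<le> 1" if "t \<ge> 0" for t
      using sqrt_one_minus_cos_error(2)[of "z t" N X xg f] zD[OF that]
      by (simp add: w_def D_def abs_square_le_1 abs_le_iff)
    fix t :: real assume t: "t \<ge> 0" "t \<notin> E"
    then obtain v where v: "v \<in> filippov_map D ?F (z t)"
      "(z has_vector_derivative v) (at t within {0..})"
      using sol by blast
    have "inverse (dst X i (fst (z t))) < \<rho>" if "i \<in> {1..N}" for i
      using assms(5)[OF that t(1)] by (simp add: z_def)
    then have "k\<theta> * sqrt (1 - (w t)\<^sup>2) \<le> cos_error_deriv N X xg f (z t) v"
      using cos_error_rate[of "z t" N X xg f \<rho> v k\<theta>] zD[OF t(1)] v(1) unfolding D_def w_def by blast
    moreover have "(w has_vector_derivative cos_error_deriv N X xg f (z t) v) (at t within {0..})"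
    proof -
      have d: "(cos_error N X xg f has_derivative cos_error_deriv N X xg f (z t)) (at (z t))"
        by (rule cos_error_has_derivative[OF zD[OF t(1), unfolded D_def]])
      have "((\<lambda>t. cos_error N X xg f (z t)) has_derivative
          (\<lambda>s. cos_error_deriv N X xg f (z t) (s *\<^sub>R v))) (at t within {0..})"
        using v(2) d unfolding has_vector_derivative_def by (rule has_derivative_compose)
      moreover have "cos_error_deriv N X xg f (z t) (s *\<^sub>R v) = s *\<^sub>R cos_error_deriv N X xg f (z t) v" for s
        using linear_scale[OF has_derivative_linear[OF d]] by blast
      ultimately show ?thesis
        by (simp add: has_vector_derivative_def w_def[abs_def])
    qed
    ultimately show "\<exists>d\<ge>k\<theta> * sqrt (1 - (w t)\<^sup>2). (w has_vector_derivative d) (at t within {0..})"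
      by blast
  qed (use neg assms(3) in auto)
  \<comment> \<open>From time \<open>T\<close> on the unicycle is aligned with the gradient, in one of the two orientations.\<close>
  have vel: "xvel N X xg f (z t) = gfield N X xg f (x t)" if "t \<ge> T" for t
  proof -
    have "(w t)\<^sup>2 = 1" using T(2) that by auto
    then show ?thesis
      using xvel_eq_gfield[of "x t" "\<theta> t" N X xg f] zD[of t] that T(1) by (simp add: w_def z_def D_def)
  qed
  have "(x has_vector_derivative - grad (cost N X xg f) (x t)) (at t)" if "t > T" for t
  proof -
    have acz: "abs_continuous_on {T..t + 1} z"
      using ac[of "t + 1"] that T(1) by (auto intro: abs_continuous_on_subset)
    have acx: "abs_continuous_on {T..t + 1} x"
      using abs_continuous_on_dominated[OF acz, of x 1] norm_fst_le by (force simp: z_def)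
    have cont: "continuous_on {T..t + 1} (\<lambda>s. gfield N X xg f (x s))"
    proof -
      have "continuous_on {T..t + 1} (\<lambda>s. gfield N X xg f (fst (z s)))"
        by (rule continuous_on_compose2[OF continuous_on_control_region(1)
              abs_continuous_on_imp_continuous_on[OF acz]])
          (rule image_subsetI, rule zD[unfolded D_def], use T(1) in simp)
      then show ?thesis by (simp add: z_def)
    qed
    have "(x has_vector_derivative gfield N X xg f (x s)) (at s within {T..t + 1})"
      if s: "s \<in> {T..t + 1} - E" for s
    proof -
      have s0: "s \<ge> 0" "s \<notin> E" "s \<ge> T" using s T(1) by auto
      then obtain v where v: "v \<in> filippov_map D ?F (z s)"
        "(z has_vector_derivative v) (at s within {0..})"
        using sol by blast
      have "fst v = gfield N X xg f (x s)"
        using filippov_map_velocity[of "z s" N X xg f v \<rho> k\<theta>] zD[OF s0(1)] v(1) vel[OF s0(3)]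
        unfolding D_def by simp
      moreover have "((\<lambda>s. fst (z s)) has_vector_derivative fst v) (at s within {0..})"
        using v(2) by (rule bounded_linear.has_vector_derivative[OF bounded_linear_fst])
      ultimately have "(x has_vector_derivative gfield N X xg f (x s)) (at s within {0..})"
        by (simp add: z_def)
      then show ?thesis
        by (rule has_vector_derivative_within_subset) (use T(1) in auto)
    qed
    from abs_continuous_has_continuous_derivative[OF acx neg this cont, of t]
    have "(x has_vector_derivative gfield N X xg f (x t)) (at t within {T..t + 1})"
      using that by simp
    moreover have "at t within {T..t + 1} = at t"
      using that by (intro at_within_interior) simp
    moreover have "gfield N X xg f (x t) = - grad (cost N X xg f) (x t)"
      using control_regionD(3)[of "x t" N X xg f] zD[of t] that T(1)
      by (simp add: D_def z_def negrad_def)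
    ultimately show ?thesis by simp
  qed
  then show ?thesis using T(1) by blast
qed

end
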